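(* Let $n\geq 9$ be an integer. If $1\neq\delta\in A_n$ is a $p$-cycle, where $p$ is a prime with $p\geq n-2$, then $v_\delta$ is an isolated vertex of the divisibility graph $D(A_n)$. All the other vertices of $D(A_n)$ (those not of the form $v_\delta$ with $\delta$ a $p$-cycle, $p\ge n-2$ prime) lie in a single connected component.
   Context: For a finite group $G$ and $g\in G$, let $g^G=\{x^{-1}gx : x\in G\}$ be the conjugacy class of $g$. The divisibility graph $D(G)$ is the graph whose vertex set is the set of integers $\{|g^G| : g\in G\}\setminus\{1\}$ (conjugacy class sizes different from $1$), where $a$ and $b$ are adjacent whenever $a$ divides $b$ or $b$ divides $a$. The vertex corresponding to $|g^G|$ is denoted $v_g$; thus $v_g=v_h$ whenever $|g^G|=|h^G|$. A vertex is isolated if it is not adjacent to any other vertex. $A_n$ is the alternating group on $n$ points. *)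

theory Defs
  imports
    "HOL-Algebra.Sym_Groups"
    "HOL-Computational_Algebra.Primes"
    "Graph_Theory.Graph_Theory"
begin

definition conj_class :: "('a, 'b) monoid_scheme \<Rightarrow> 'a \<Rightarrow> 'a set" where
  "conj_class G g = {inv\<^bsub>G\<^esub> x \<otimes>\<^bsub>G\<^esub> g \<otimes>\<^bsub>G\<^esub> x | x. x \<in> carrier G}"

definition div_vertex :: "('a, 'b) monoid_scheme \<Rightarrow> 'a \<Rightarrow> nat" where
  "div_vertex G g = card (conj_class G g)"

text \<open>
  The divisibility graph of a finite group. An undirected simple graph is represented as a
  loop-free symmetric digraph, so \<open>u\<close> and \<open>v\<close> are adjacent iff both \<open>(u, v)\<close> and \<open>(v, u)\<close>
  are arcs. On infinite groups the definition is meaningless, since infinite classes have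
  \<open>card\<close> equal to \<open>0\<close>.
\<close>
definition div_graph :: "('a, 'b) monoid_scheme \<Rightarrow> nat pair_pre_digraph" where
  "div_graph G =
    (let V = div_vertex G ` carrier G - {1}
     in \<lparr>pverts = V,
         parcs = {(a, b). a \<in> V \<and> b \<in> V \<and> a \<noteq> b \<and> (a dvd b \<or> b dvd a)}\<rparr>)"

lemma pair_graph_div_graph:
  assumes "finite (carrier G)"
  shows "pair_graph (div_graph G)"
proof -
  let ?V = "pverts (div_graph G)"
  have V: "finite ?V"
    using assms by (simp add: div_graph_def Let_def)
  have "parcs (div_graph G) \<subseteq> ?V \<times> ?V"
    by (auto simp: div_graph_def Let_def)
  then have A: "finite (parcs (div_graph G))"
    using V by (meson finite_SigmaI finite_subset)
  show ?thesis
    by unfold_locales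
      (use V A in \<open>auto simp: div_graph_def Let_def symmetric_def sym_def\<close>)
qed

definition isolated_vertex :: "'a pair_pre_digraph \<Rightarrow> 'a \<Rightarrow> bool" where
  "isolated_vertex D v \<longleftrightarrow>
    v \<in> pverts D \<and> \<not> (\<exists>w \<in> pverts D. w \<noteq> v \<and> ((v, w) \<in> parcs D \<or> (w, v) \<in> parcs D))"

text \<open>
  In a symmetric digraph the strongly connected components are the connected components of
  the underlying undirected graph.
\<close>
definition conn_components :: "'a pair_pre_digraph \<Rightarrow> ('a, 'a \<times> 'a) pre_digraph set" where
  "conn_components D = pre_digraph.sccs (with_proj D)"

text \<open>
  The \<open>k\<close>-cycles on \<open>{1..n}\<close>, as in \<^const>\<open>three_cycles\<close>; intended for \<open>k \<ge> 2\<close>, as lists of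
  length at most \<open>1\<close> yield the identity.
\<close>
definition k_cycles :: "nat \<Rightarrow> nat \<Rightarrow> (nat \<Rightarrow> nat) set" where
  "k_cycles n k = {cycle_of_list cs | cs. cycle cs \<and> length cs = k \<and> set cs \<subseteq> {1..n}}"

end

theory Submission
  imports Defs "HOL-Algebra.Sylow" "HOL-Algebra.Multiplicative_Group" "HOL-Combinatorics.Orbits"
begin

text \<open>
  Write \<open>C(g)\<close> for the centralizer of \<open>g\<close> in the alternating group. Since class size times
  centralizer order is the group order, the vertex of \<open>h\<close> divides the vertex of \<open>g\<close> iff
  \<open>|C(g)|\<close> divides \<open>|C(h)|\<close> (\<open>div_vertex_dvd_iff\<close>). In particular \<open>g\<close> and each of
  its nontrivial powers have equal or adjacent vertices, and two commuting elements of different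
  prime orders are connected through their product. The whole graph can thus be studied through
  centralizers.

  Isolated vertices (\<open>isolated_large_prime\<close>). If \<open>p \<ge> n - 2\<close> is prime then a nontrivial element
  with \<open>p\<close>-th power \<open>1\<close> is a \<open>p\<close>-cycle, and its centralizer in the alternating group has order
  exactly \<open>p\<close>. If \<open>|C(g)|\<close> divides \<open>p\<close> it equals \<open>p\<close>. If \<open>p\<close> divides \<open>|C(g)|\<close>, then by Cauchy \<open>g\<close>
  commutes with an element \<open>h\<close> of order \<open>p\<close>; so \<open>g\<close> lies in the group \<open>C(h)\<close> of order \<open>p\<close>, hence has
  order \<open>p\<close> itself, and again \<open>|C(g)| = p\<close>. A neighbour of the vertex of a \<open>p\<close>-cycle is therefore
  that vertex itself.

  Connectedness (\<open>linked_three_cycle_of_prime_order\<close>). Any \<open>g \<noteq> 1\<close> is linked to a power \<open>x\<close> of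
  prime order \<open>q\<close>. If \<open>q \<ge> n - 2\<close>, then \<open>|C(g)|\<close> divides \<open>q\<close>, so \<open>g\<close> and the \<open>q\<close>-cycle \<open>x\<close> have the
  same vertex. Otherwise \<open>q \<le> n - 3\<close>, and \<open>x\<close> is connected to a 3-cycle, all 3-cycles having the
  same centralizer order \<open>3 (n - 3)! / 2\<close>. Let \<open>x\<close> have \<open>k\<close> cycles of length \<open>q\<close>.

  \<^item> For \<open>q \<noteq> 3\<close> and three points outside the support, \<open>x\<close> commutes with a disjoint 3-cycle. For
    \<open>q \<noteq> 3\<close> and \<open>k \<ge> 3\<close>, it commutes with an element of order 3 rotating three of its cycles.
    This covers \<open>q = 2\<close>, where \<open>k \<le> 2\<close> means at most four moved points, and \<open>k = 1\<close>. What
    remains is \<open>q \<ge> 5\<close>, \<open>k = 2\<close>: there \<open>|C(x)|\<close> divides the centralizer order of one of the two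
    cycles of \<open>x\<close>, which fixes at least \<open>q\<close> points.
  \<^item> For \<open>q = 3\<close> and \<open>k \<ge> 4\<close>, \<open>x\<close> commutes with the involution swapping two pairs of its cycles.
  \<^item> For \<open>q = 3\<close> and \<open>k = 2\<close>, \<open>|C(x)|\<close> divides \<open>9 (n - 6)!\<close>, which divides \<open>3 (n - 3)! / 2\<close>. For
    \<open>q = 3\<close> and \<open>k = 3\<close>, \<open>x\<close> is the cube of a 9-cycle \<open>y\<close>, and \<open>|C(y)|\<close> divides \<open>9 (n - 9)!\<close>, which
    again divides \<open>3 (n - 3)! / 2\<close>.

  The reduction of \<open>q = 3\<close>, \<open>k \<ge> 4\<close> to involutions is not circular: an involution with many
  transpositions is sent to the rotation of three of them, an element of order 3 with \<open>k = 2\<close>.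
  Centralizers need to be counted only for one long cycle and for two cycles of equal length.
\<close>

section \<open>Class sizes and centralizer orders\<close>

text \<open>
  Conjugating \<open>g\<close> by \<open>x\<close> and by \<open>y\<close> gives the same result iff \<open>x\<close> and \<open>y\<close> lie in the same
  coset of the centralizer, so each element of the class is obtained equally often.
\<close>
lemma card_conj_class_times_centralizer:
  assumes "group G" and fin: "finite (carrier G)" and g: "g \<in> carrier G"
  shows "card (conj_class G g) * card {x \<in> carrier G. x \<otimes>\<^bsub>G\<^esub> g = g \<otimes>\<^bsub>G\<^esub> x} = card (carrier G)"
proof -
  interpret group G by fact
  define C where "C = {x \<in> carrier G. x \<otimes>\<^bsub>G\<^esub> g = g \<otimes>\<^bsub>G\<^esub> x}"
  define F where "F c = {x \<in> carrier G. inv\<^bsub>G\<^esub> x \<otimes>\<^bsub>G\<^esub> g \<otimes>\<^bsub>G\<^esub> x = c}" for c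
  have same: "inv\<^bsub>G\<^esub> y \<otimes>\<^bsub>G\<^esub> g \<otimes>\<^bsub>G\<^esub> y = inv\<^bsub>G\<^esub> x \<otimes>\<^bsub>G\<^esub> g \<otimes>\<^bsub>G\<^esub> x \<longleftrightarrow> y \<otimes>\<^bsub>G\<^esub> inv\<^bsub>G\<^esub> x \<in> C"
    if "x \<in> carrier G" "y \<in> carrier G" for x y
  proof -
    have "y \<otimes>\<^bsub>G\<^esub> inv\<^bsub>G\<^esub> x \<in> C \<longleftrightarrow> y \<otimes>\<^bsub>G\<^esub> (inv\<^bsub>G\<^esub> x \<otimes>\<^bsub>G\<^esub> g) = g \<otimes>\<^bsub>G\<^esub> (y \<otimes>\<^bsub>G\<^esub> inv\<^bsub>G\<^esub> x)"
      using that g by (simp add: C_def m_assoc)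
    also have "\<dots> \<longleftrightarrow> inv\<^bsub>G\<^esub> x \<otimes>\<^bsub>G\<^esub> g = inv\<^bsub>G\<^esub> y \<otimes>\<^bsub>G\<^esub> (g \<otimes>\<^bsub>G\<^esub> (y \<otimes>\<^bsub>G\<^esub> inv\<^bsub>G\<^esub> x))"
      using that g by (metis inv_closed inv_solve_left m_closed)
    also have "\<dots> \<longleftrightarrow> inv\<^bsub>G\<^esub> x \<otimes>\<^bsub>G\<^esub> g = (inv\<^bsub>G\<^esub> y \<otimes>\<^bsub>G\<^esub> g \<otimes>\<^bsub>G\<^esub> y) \<otimes>\<^bsub>G\<^esub> inv\<^bsub>G\<^esub> x"
      using that g by (simp add: m_assoc)
    also have "\<dots> \<longleftrightarrow> inv\<^bsub>G\<^esub> x \<otimes>\<^bsub>G\<^esub> g \<otimes>\<^bsub>G\<^esub> x = inv\<^bsub>G\<^esub> y \<otimes>\<^bsub>G\<^esub> g \<otimes>\<^bsub>G\<^esub> y"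
      using that g by (metis inv_closed inv_solve_right m_closed)
    finally show ?thesis by auto
  qed
  have "card (F c) = card C" if c: "c \<in> conj_class G g" for c
  proof -
    obtain x where x: "x \<in> carrier G" "c = inv\<^bsub>G\<^esub> x \<otimes>\<^bsub>G\<^esub> g \<otimes>\<^bsub>G\<^esub> x"
      using c by (auto simp: conj_class_def)
    have "F c = (\<lambda>y. y \<otimes>\<^bsub>G\<^esub> x) ` C"
    proof (intro Set.set_eqI iffI)
      fix y assume "y \<in> F c"
      then have y: "y \<in> carrier G" "y \<otimes>\<^bsub>G\<^esub> inv\<^bsub>G\<^esub> x \<in> C" using same x by (auto simp: F_def)
      moreover have "y = (y \<otimes>\<^bsub>G\<^esub> inv\<^bsub>G\<^esub> x) \<otimes>\<^bsub>G\<^esub> x" using x y(1) by (simp add: m_assoc)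
      ultimately show "y \<in> (\<lambda>y. y \<otimes>\<^bsub>G\<^esub> x) ` C" by blast
    next
      fix y assume "y \<in> (\<lambda>y. y \<otimes>\<^bsub>G\<^esub> x) ` C"
      then obtain z where z: "z \<in> C" "y = z \<otimes>\<^bsub>G\<^esub> x" by blast
      then have "z \<in> carrier G" by (simp add: C_def)
      then have "y \<in> carrier G" "y \<otimes>\<^bsub>G\<^esub> inv\<^bsub>G\<^esub> x = z" using z x by (auto simp: m_assoc)
      then show "y \<in> F c" using same x z by (auto simp: F_def)
    qed
    moreover have "inj_on (\<lambda>y. y \<otimes>\<^bsub>G\<^esub> x) C"
      using x by (auto intro!: inj_onI simp: C_def)
    ultimately show ?thesis by (simp add: card_image)
  qed
  moreover have "carrier G = (\<Union>c \<in> conj_class G g. F c)"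
    by (auto simp: F_def conj_class_def)
  moreover have "card (\<Union>c \<in> conj_class G g. F c) = (\<Sum>c \<in> conj_class G g. card (F c))"
  proof (rule card_UN_disjoint)
    have "conj_class G g = (\<lambda>x. inv\<^bsub>G\<^esub> x \<otimes>\<^bsub>G\<^esub> g \<otimes>\<^bsub>G\<^esub> x) ` carrier G"
      by (auto simp: conj_class_def)
    then show "finite (conj_class G g)" using fin by simp
  qed (use fin in \<open>auto simp: F_def\<close>)
  ultimately show ?thesis by (simp add: C_def)
qed

definition cent :: "'a set \<Rightarrow> ('a \<Rightarrow> 'a) \<Rightarrow> ('a \<Rightarrow> 'a) set" where
  "cent S x = {g. g permutes S \<and> g \<circ> x = x \<circ> g}"

definition alt_cent :: "nat \<Rightarrow> (nat \<Rightarrow> nat) \<Rightarrow> (nat \<Rightarrow> nat) set" where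
  "alt_cent n x = {g \<in> cent {1..n} x. evenperm g}"

abbreviation alt :: "nat \<Rightarrow> (nat \<Rightarrow> nat) set" where
  "alt n \<equiv> carrier (alt_group n)"

lemma finite_alt: "finite (alt n)"
proof -
  have "alt n \<subseteq> {p. p permutes {1..n}}" by (auto simp: alt_group_carrier)
  then show ?thesis using finite_permutations[of "{1..n}"] finite_subset by blast
qed

lemma div_vertex_times_alt_cent:
  assumes "g \<in> alt n"
  shows "div_vertex (alt_group n) g * card (alt_cent n g) = card (alt n)"
proof -
  have "{x \<in> alt n. x \<otimes>\<^bsub>alt_group n\<^esub> g = g \<otimes>\<^bsub>alt_group n\<^esub> x} = alt_cent n g"
    by (auto simp: alt_cent_def cent_def alt_group_carrier alt_group_mult)
  then show ?thesis
    using card_conj_class_times_centralizer[OF alt_group_is_group finite_alt assms]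
    by (simp add: div_vertex_def)
qed

lemma alt_cent_subgroup: 
  assumes "g \<in> alt n"
  shows "subgroup (alt_cent n g) (alt_group n)"
proof -
  interpret group "alt_group n" by (rule alt_group_is_group)
  show ?thesis
  proof (rule subgroupI)
    show "alt_cent n g \<noteq> {}"
      by (auto simp: alt_cent_def cent_def intro!: exI[of _ id] permutes_id)
  next
    fix a assume a: "a \<in> alt_cent n g"
    then have "a \<in> alt n" by (auto simp: alt_cent_def cent_def alt_group_carrier)
    moreover have "inv' a \<circ> g = g \<circ> inv' a"
    proof -
      have b: "bij a" and c: "a \<circ> g = g \<circ> a" using a by (auto simp: alt_cent_def cent_def permutes_bij)
      have "inv' a \<circ> (a \<circ> g) \<circ> inv' a = inv' a \<circ> (g \<circ> a) \<circ> inv' a" using c by simp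
      then show ?thesis using b by (simp add: fun_eq_iff bij_is_inj bij_is_surj surj_f_inv_f)
    qed
    ultimately show "inv\<^bsub>alt_group n\<^esub> a \<in> alt_cent n g"
      using alt_group_inv_closed[of a n] by (simp add: alt_group_inv_equality alt_cent_def cent_def alt_group_carrier)
  next
    fix a b assume ab: "a \<in> alt_cent n g" "b \<in> alt_cent n g"
    then have "a \<in> alt n" "b \<in> alt n" by (auto simp: alt_cent_def cent_def alt_group_carrier)
    then have "a \<otimes>\<^bsub>alt_group n\<^esub> b \<in> alt n" by (rule m_closed)
    moreover have "(a \<circ> b) \<circ> g = g \<circ> (a \<circ> b)"
      using ab by (simp add: alt_cent_def cent_def comp_assoc) (simp flip: comp_assoc)
    ultimately show "a \<otimes>\<^bsub>alt_group n\<^esub> b \<in> alt_cent n g"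
      by (simp add: alt_group_mult alt_cent_def cent_def alt_group_carrier)
  qed (auto simp: alt_cent_def cent_def alt_group_carrier)
qed

lemma finite_alt_cent: "finite (alt_cent n g)"
  by (rule finite_subset[OF _ finite_alt[of n]]) (auto simp: alt_cent_def cent_def alt_group_carrier)

lemma card_subgroup_dvd_card_subgroup:
  assumes "group G" "subgroup H G" "subgroup K G" "H \<subseteq> K"
  shows "card H dvd card K"
proof -
  interpret group G by fact
  interpret K: group "G\<lparr>carrier := K\<rparr>" using assms(3) by (rule subgroup_imp_group)
  have "subgroup H (G\<lparr>carrier := K\<rparr>)" using assms by (simp add: subgroup_incl)
  from K.lagrange[OF this] show ?thesis
    by (metis dvd_triv_right order_def partial_object.select_convs(1) partial_object.surjective partial_object.update_convs(1))
qed

lemma card_alt_cent_dvd: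
  assumes "g \<in> alt n" "h \<in> alt n" "alt_cent n g \<subseteq> alt_cent n h"
  shows "card (alt_cent n g) dvd card (alt_cent n h)"
  using card_subgroup_dvd_card_subgroup[OF alt_group_is_group] alt_cent_subgroup assms by blast

lemma card_alt_cent_pos: "card (alt_cent n g) > 0"
proof -
  have "id \<in> alt_cent n g" by (auto simp: alt_cent_def cent_def permutes_id)
  then show ?thesis using finite_alt_cent card_gt_0_iff by blast
qed

text \<open>
  Divisibility of class sizes is reverse divisibility of centralizer orders; from here on only
  the latter are considered.
\<close>
lemma div_vertex_dvd_iff:
  assumes "g \<in> alt n" "h \<in> alt n"
  shows "div_vertex (alt_group n) h dvd div_vertex (alt_group n) g \<longleftrightarrow>
     card (alt_cent n g) dvd card (alt_cent n h)"
proof -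
  let ?v = "div_vertex (alt_group n)" and ?c = "\<lambda>x. card (alt_cent n x)"
  have eq: "?v g * ?c g = ?v h * ?c h"
    using div_vertex_times_alt_cent assms by simp
  have "?v g * ?c g > 0" "?v h * ?c h > 0"
    using div_vertex_times_alt_cent[OF assms(1)] div_vertex_times_alt_cent[OF assms(2)] finite_alt assms
    by (metis card_gt_0_iff empty_iff)+
  then have pos: "?v g > 0" "?v h > 0" "?c g > 0" "?c h > 0" by auto
  show ?thesis
  proof
    assume "?v h dvd ?v g"
    then obtain k where "?v g = ?v h * k" by blast
    with eq pos have "?c h = ?c g * k" by (simp add: mult_ac)
    then show "?c g dvd ?c h" by simp
  next
    assume "?c g dvd ?c h"
    then obtain k where k: "?c h = ?c g * k" by blast
    have "?c g * ?v g = ?c g * (?v h * k)" using eq unfolding k by (simp add: mult_ac)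
    with pos have "?v g = ?v h * k" by simp
    then show "?v h dvd ?v g" by simp
  qed
qed

lemma div_vertex_id: "div_vertex (alt_group n) id = 1"
proof -
  have "alt_cent n id = alt n" by (auto simp: alt_cent_def cent_def alt_group_carrier)
  moreover have "id \<in> alt n" by (simp add: alt_group_carrier permutes_id)
  ultimately show ?thesis
    using div_vertex_times_alt_cent[of id n] card_alt_cent_pos[of n id] by simp
qed

text \<open>
  The sign is multiplicative, and \<open>-1\<close> has no odd power equal to \<open>1\<close>.
\<close>
lemma evenperm_odd_order:
  assumes "permutation g" "(g ^^ k) = id" "odd k"
  shows "evenperm g"
proof (rule ccontr)
  assume "\<not> evenperm g"
  then have s: "sign g = -1" by (simp add: sign_def)
  have "sign (g ^^ k) = (sign g) ^ k" for k
  proof (induction k)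
    case (Suc k)
    then show ?case
      using sign_compose[OF assms(1) permutation_funpow[OF assms(1)], of k] by (simp add: o_def)
  qed simp
  from this[of k] s assms show False by simp
qed

lemma evenperm_square:
  assumes "permutation g"
  shows "evenperm (g \<circ> g)"
  using assms by (simp add: evenperm_comp)

lemma cycle_of_list_3_in_alt:
  assumes "distinct [a,b,c]" "{a,b,c} \<subseteq> {1..n}"
  shows "cycle_of_list [a,b,c] \<in> alt n"
proof -
  have "cycle_of_list [a,b,c] permutes {1..n}"
    using permutes_subset[OF cycle_permutes[of "[a,b,c]"], of "{1..n}"] assms by simp
  moreover have "evenperm (cycle_of_list [a,b,c])"
    using cycle_is_id_root[OF assms(1)]
    by (intro evenperm_odd_order[OF permutation_of_cycle, where k = 3]) (simp_all add: numeral_3_eq_3)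
  ultimately show ?thesis by (simp add: alt_group_carrier)
qed

text \<open>
  The alternating group has trivial centre: if \<open>g\<close> moves \<open>u\<close>, then a 3-cycle that fixes \<open>u\<close> and
  moves \<open>g u\<close> does not commute with \<open>g\<close>.
\<close>
lemma div_vertex_eq_1_iff:
  assumes "n \<ge> 4" "g \<in> alt n"
  shows "div_vertex (alt_group n) g = 1 \<longleftrightarrow> g = id"
proof
  assume v: "div_vertex (alt_group n) g = 1"
  show "g = id"
  proof (rule ccontr)
    assume "g \<noteq> id"
    then obtain u where u: "g u \<noteq> u" by (auto simp: fun_eq_iff)
    have gp: "g permutes {1..n}" using assms by (simp add: alt_group_carrier)
    have un: "u \<in> {1..n}" "g u \<in> {1..n}"
      using u gp permutes_in_image[OF gp] by (auto simp: permutes_def)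
    have "card ({1..n} - {u, g u}) \<ge> 2"
      using un u assms by (simp add: card_Diff_subset)
    then obtain w z where wz: "{w, z} \<subseteq> {1..n} - {u, g u}" "w \<noteq> z"
      by (metis card_2_iff card_le_Suc_iff numeral_2_eq_2 obtain_subset_with_card_n)
    \<comment> \<open>\<open>?c\<close> fixes \<open>u\<close> but not \<open>g u\<close>\<close>
    let ?c = "cycle_of_list [g u, w, z]"
    have "?c \<in> alt n" using cycle_of_list_3_in_alt[of "g u" w z n] wz un by auto
    moreover have "?c \<notin> alt_cent n g"
    proof
      assume "?c \<in> alt_cent n g"
      then have "?c (g u) = g (?c u)" by (simp add: alt_cent_def cent_def fun_eq_iff)
      then show False using wz u by (auto simp: transpose_def split: if_splits)
    qed
    moreover have "alt_cent n g \<subseteq> alt n" by (auto simp: alt_cent_def cent_def alt_group_carrier)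
    ultimately have "card (alt_cent n g) < card (alt n)"
      using finite_alt by (metis psubsetI psubset_card_mono)
    then show False using div_vertex_times_alt_cent[OF assms(2)] v by simp
  qed
qed (simp add: div_vertex_id)

section \<open>The divisibility graph of an alternating group\<close>

text \<open>
  Connectedness in the graph, as a relation on group elements. Vertices of the graph are
  numbers, but every edge that is used comes from an inclusion or a count of centralizers.
\<close>
definition linked :: "nat \<Rightarrow> (nat \<Rightarrow> nat) \<Rightarrow> (nat \<Rightarrow> nat) \<Rightarrow> bool" where
  "linked n g h \<longleftrightarrow> div_vertex (alt_group n) g \<rightarrow>\<^sup>*\<^bsub>with_proj (div_graph (alt_group n))\<^esub> div_vertex (alt_group n) h"

lemma pair_graph_alt: "pair_graph (div_graph (alt_group n))"
  by (rule pair_graph_div_graph[OF finite_alt])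

lemma linked_sym: "linked n g h \<Longrightarrow> linked n h g"
proof -
  interpret pair_graph "div_graph (alt_group n)" by (rule pair_graph_alt)
  show "linked n g h \<Longrightarrow> linked n h g"
    unfolding linked_def by (rule symmetric_reachable[OF sym_arcs])
qed

lemma linked_trans: "linked n g h \<Longrightarrow> linked n h k \<Longrightarrow> linked n g k"
proof -
  interpret pair_graph "div_graph (alt_group n)" by (rule pair_graph_alt)
  show "linked n g h \<Longrightarrow> linked n h k \<Longrightarrow> linked n g k"
    unfolding linked_def by (rule reachable_trans)
qed

lemma pverts_alt:
  assumes "n \<ge> 4"
  shows "pverts (div_graph (alt_group n)) = div_vertex (alt_group n) ` (alt n - {id})"
  using div_vertex_eq_1_iff[OF assms] by (auto simp: div_graph_def Let_def)

lemma linked_dvd: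
  assumes "n \<ge> 4" "g \<in> alt n" "h \<in> alt n" "g \<noteq> id" "h \<noteq> id"
    and "card (alt_cent n g) dvd card (alt_cent n h)"
  shows "linked n g h"
proof -
  interpret pair_graph "div_graph (alt_group n)" by (rule pair_graph_alt)
  let ?v = "div_vertex (alt_group n)"
  have V: "?v g \<in> pverts (div_graph (alt_group n))" "?v h \<in> pverts (div_graph (alt_group n))"
    using pverts_alt[OF assms(1)] assms by auto
  show ?thesis
  proof (cases "?v g = ?v h")
    case True
    then show ?thesis using V reachable_refl by (simp add: linked_def)
  next
    case False
    have "?v h dvd ?v g" using div_vertex_dvd_iff assms by blast
    then have "(?v g, ?v h) \<in> parcs (div_graph (alt_group n))"
      using V False by (auto simp: div_graph_def Let_def)
    then show ?thesis unfolding linked_def by (rule reachable_adjI)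
  qed
qed

lemma component_of_linked:
  assumes "n \<ge> 4" "h \<in> alt n" "h \<noteq> id"
  shows "\<exists>C \<in> conn_components (div_graph (alt_group n)).
    verts C = {v. v \<rightarrow>\<^sup>*\<^bsub>with_proj (div_graph (alt_group n))\<^esub> div_vertex (alt_group n) h}"
proof -
  interpret pair_graph "div_graph (alt_group n)" by (rule pair_graph_alt)
  let ?w = "div_vertex (alt_group n) h"
  have "?w \<in> pverts (div_graph (alt_group n))" using pverts_alt assms by auto
  then have "scc_of ?w \<in> sccs_verts" by (rule scc_of_in_sccs_verts)
  then obtain C where "C \<in> sccs" "verts C = scc_of ?w" by (auto simp: sccs_verts_conv)
  moreover have "scc_of ?w = {v. v \<rightarrow>\<^sup>*\<^bsub>with_proj (div_graph (alt_group n))\<^esub> ?w}"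
    unfolding scc_of_def using symmetric_reachable[OF sym_arcs] by blast
  ultimately show ?thesis by (auto simp: conn_components_def)
qed

section \<open>Centralizers of permutations\<close>

lemma disjoint_permutes_commute:
  assumes "p permutes A" "q permutes B" "A \<inter> B = {}"
  shows "p \<circ> q = q \<circ> p"
proof
  fix z
  have p: "p y = y" if "y \<notin> A" for y using assms(1) that by (simp add: permutes_def)
  have q: "q y = y" if "y \<notin> B" for y using assms(2) that by (simp add: permutes_def)
  consider "z \<in> A" "p z \<in> A" "z \<notin> B" "p z \<notin> B" | "z \<in> B" "q z \<in> B" "z \<notin> A" "q z \<notin> A"
    | "z \<notin> A" "z \<notin> B"
    using permutes_in_image[OF assms(1), of z] permutes_in_image[OF assms(2), of z] assms(3) by blast
  then show "(p \<circ> q) z = (q \<circ> p) z" by cases (simp_all add: p q)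
qed

lemma cyclic_on_moves:
  assumes "a permutes S" "finite S" "cyclic_on a A" "A \<noteq> {z}" "z \<in> A"
  shows "a z \<noteq> z"
  using assms by (metis cyclic_on_alldef orbit_eq_singleton_iff)

lemma funpow_commute:
  assumes "g \<circ> x = x \<circ> g"
  shows "g ((x ^^ i) u) = (x ^^ i) (g u)"
proof (induction i)
  case (Suc i)
  have "g (x z) = x (g z)" for z using assms by (simp add: fun_eq_iff)
  with Suc show ?case by simp
qed simp

lemma in_orbit_funpow:
  assumes "permutation x" "z \<in> orbit x u"
  shows "\<exists>i. z = (x ^^ i) u"
  using assms orbit_altdef_permutation by fastforce

text \<open>
  A permutation commuting with the cycle \<open>a\<close> on \<open>A\<close> preserves \<open>A\<close> and acts on it as a power of \<open>a\<close>,
  which is determined by the image of one point. Splitting off this power leaves an arbitrary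
  permutation of the complement that commutes with \<open>b\<close>. Carrying \<open>b\<close> along allows the lemma to be
  applied to several disjoint cycles in turn.
\<close>
lemma card_cent_Int_cyclic:
  assumes fin: "finite S" and AS: "A \<subseteq> S" and aA: "a permutes A" and cyc: "cyclic_on a A"
    and card: "card A \<ge> 2" and b: "b permutes S - A"
  shows "card (cent S a \<inter> cent S b) = card A * card (cent (S - A) b)"
proof -
  obtain u where u: "u \<in> A" "A = orbit a u" using cyc by (auto simp: cyclic_on_def)
  have finA: "finite A" using AS fin finite_subset by blast
  have perm: "permutation a" using aA finA permutation_permutes by blast
  have moves: "a z \<noteq> z \<longleftrightarrow> z \<in> A" for z
  proof -
    have "A \<noteq> {z}" using card by auto
    then show ?thesis using cyclic_on_moves[OF aA finA cyc, of z] aA by (auto simp: permutes_def)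
  qed
  have apow: "(a ^^ i) permutes A" for i using aA by (rule permutes_funpow)
  \<comment> \<open>an exponent taking the base point \<open>u\<close> to \<open>z\<close>\<close>
  define e where "e z = (SOME i. (a ^^ i) u = z)" for z
  have e: "(a ^^ e z) u = z" if "z \<in> A" for z
    using someI_ex[of "\<lambda>i. (a ^^ i) u = z"] in_orbit_funpow[OF perm, of z u] that u(2)
    unfolding e_def by metis
  let ?W = "cent (S - A) b"
  have "bij_betw (\<lambda>(z, w). (a ^^ e z) \<circ> w) (A \<times> ?W) (cent S a \<inter> cent S b)"
  proof (rule bij_betwI')
    fix p q assume "p \<in> A \<times> ?W" "q \<in> A \<times> ?W"
    then obtain z w z' w' where pq: "p = (z, w)" "q = (z', w')" "z \<in> A" "z' \<in> A"
      and w: "w permutes S - A" "w' permutes S - A" by (auto simp: cent_def)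
    show "(case p of (z, w) \<Rightarrow> (a ^^ e z) \<circ> w) = (case q of (z, w) \<Rightarrow> (a ^^ e z) \<circ> w) \<longleftrightarrow> p = q"
    proof
      assume "(case p of (z, w) \<Rightarrow> (a ^^ e z) \<circ> w) = (case q of (z, w) \<Rightarrow> (a ^^ e z) \<circ> w)"
      then have eq: "(a ^^ e z) \<circ> w = (a ^^ e z') \<circ> w'" using pq by simp
      have "w u = u" "w' u = u" using w u(1) by (auto simp: permutes_def)
      then have "z = z'" using fun_cong[OF eq, of u] e pq by simp
      moreover have "inj (a ^^ e z)" using apow permutes_inj by blast
      ultimately have "w = w'" using eq by (simp add: fun_eq_iff inj_eq)
      with \<open>z = z'\<close> show "p = q" using pq by simp
    qed simp
  next
    fix p assume "p \<in> A \<times> ?W"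
    then obtain z w where p: "p = (z, w)" "z \<in> A" and w: "w permutes S - A" "w \<circ> b = b \<circ> w"
      by (auto simp: cent_def)
    let ?g = "(a ^^ e z) \<circ> w"
    have "?g permutes S"
      using permutes_compose[OF permutes_subset[OF w(1)] permutes_subset[OF apow]] AS by blast
    moreover have "w \<circ> a = a \<circ> w" using disjoint_permutes_commute[OF w(1) aA] by blast
    then have "w (a y) = a (w y)" for y by (simp add: fun_eq_iff)
    then have "?g \<circ> a = a \<circ> ?g" by (simp add: fun_eq_iff funpow_swap1)
    moreover have "(a ^^ e z) \<circ> b = b \<circ> (a ^^ e z)"
      using disjoint_permutes_commute[OF apow b] by blast
    then have "?g \<circ> b = b \<circ> ?g" using w(2) by (simp add: fun_eq_iff)
    ultimately show "(case p of (z, w) \<Rightarrow> (a ^^ e z) \<circ> w) \<in> cent S a \<inter> cent S b"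
      using p by (simp add: cent_def)
  next
    fix g assume "g \<in> cent S a \<inter> cent S b"
    then have g: "g permutes S" "g \<circ> a = a \<circ> g" "g \<circ> b = b \<circ> g" by (auto simp: cent_def)
    have gA: "g z \<in> A \<longleftrightarrow> z \<in> A" for z
    proof -
      have "a (g z) = g (a z)" using g(2) by (simp add: fun_eq_iff)
      then show ?thesis using moves permutes_inj[OF g(1)] by (metis injD)
    qed
    have "g u \<in> A" using gA u by simp
    define h where "h = a ^^ e (g u)"
    have hA: "h permutes A" using apow by (simp add: h_def)
    have gh: "g z = h z" if z: "z \<in> A" for z
    proof -
      obtain i where i: "z = (a ^^ i) u" using in_orbit_funpow[OF perm] z u by blast
      have "g z = (a ^^ i) (g u)" using funpow_commute[OF g(2)] i by simp
      also have "\<dots> = (a ^^ i) (h u)" using e[OF \<open>g u \<in> A\<close>] by (simp add: h_def)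
      also have "\<dots> = h z"
      proof -
        have "h \<circ> a = a \<circ> h" by (simp add: h_def fun_eq_iff funpow_swap1)
        from funpow_commute[OF this, of i u] show ?thesis by (simp add: i)
      qed
      finally show ?thesis .
    qed
    define w where "w = inv' h \<circ> g"
    have gw: "g = h \<circ> w"
      using permutes_inverses(1)[OF hA] by (simp add: w_def fun_eq_iff)
    have "w permutes S"
      unfolding w_def using permutes_compose[OF g(1)] permutes_subset[OF permutes_inv[OF hA] AS] by blast
    moreover have "w z = z" if "z \<in> A" for z
      using gh[OF that] permutes_inverses(2)[OF hA] by (simp add: w_def)
    ultimately have "w permutes S - A" by (metis Diff_iff permutes_superset)
    moreover have "w \<circ> b = b \<circ> w"
    proof
      fix z
      have "h (w (b z)) = g (b z)" using gw by simp
      also have "\<dots> = b (g z)" using g(3) by (simp add: fun_eq_iff)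
      also have "\<dots> = b (h (w z))" using gw by simp
      also have "\<dots> = h (b (w z))"
        using disjoint_permutes_commute[OF hA b] by (simp add: fun_eq_iff)
      finally show "(w \<circ> b) z = (b \<circ> w) z" using permutes_inj[OF hA] by (simp add: inj_eq)
    qed
    ultimately show "\<exists>p \<in> A \<times> ?W. g = (case p of (z, w) \<Rightarrow> (a ^^ e z) \<circ> w)"
      using gw \<open>g u \<in> A\<close> by (intro bexI[of _ "(g u, w)"]) (auto simp: cent_def h_def)
  qed
  then show ?thesis by (metis bij_betw_same_card card_cartesian_product)
qed

lemma card_cent_id: "finite S \<Longrightarrow> card (cent S id) = fact (card S)"
  by (simp add: cent_def card_permutations)

lemma card_cent_cyclic:
  assumes "finite S" "A \<subseteq> S" "a permutes A" "cyclic_on a A" "card A \<ge> 2"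
  shows "card (cent S a) = card A * fact (card S - card A)"
proof -
  have "cent S a \<inter> cent S id = cent S a" by (auto simp: cent_def)
  moreover have "card (S - A) = card S - card A"
    using assms finite_subset by (metis card_Diff_subset)
  ultimately show ?thesis
    using card_cent_Int_cyclic[OF assms, of id] assms(1) by (simp add: card_cent_id permutes_id)
qed

lemma card_cent_two_cyclic:
  assumes "finite S" "A \<subseteq> S" "a permutes A" "cyclic_on a A" "card A \<ge> 2"
    "B \<subseteq> S" "b permutes B" "cyclic_on b B" "card B \<ge> 2" "A \<inter> B = {}"
  shows "card (cent S a \<inter> cent S b) = card A * (card B * fact (card S - card A - card B))"
proof -
  have "card (S - A) = card S - card A"
    using assms finite_subset by (metis card_Diff_subset)
  moreover have "b permutes S - A" by (rule permutes_subset[OF assms(7)]) (use assms in blast)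
  moreover have "B \<subseteq> S - A" using assms by blast
  ultimately show ?thesis
    using card_cent_Int_cyclic[OF assms(1-5), of b] card_cent_cyclic[of "S - A" B b] assms by simp
qed

text \<open>
  A coset argument without groups: if \<open>H\<close> is the union of \<open>K\<close> and the single translate of \<open>K\<close> by
  \<open>s\<close>, then its size is twice that of \<open>K\<close>. It serves both for the even elements of a centralizer and
  for the elements that do not swap two cycles.
\<close>
lemma card_index_two:
  assumes fin: "finite H" and sub: "K \<subseteq> H" and s: "s \<in> H - K" and inj: "inj s"
    and KH: "\<And>k. k \<in> K \<Longrightarrow> s \<circ> k \<in> H - K"
    and HK: "\<And>g. g \<in> H - K \<Longrightarrow> inv' s \<circ> g \<in> K"
    and surj: "surj s"
  shows "card H = 2 * card K"
proof -
  have "(\<lambda>k. s \<circ> k) ` K = H - K"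
  proof
    show "H - K \<subseteq> (\<lambda>k. s \<circ> k) ` K"
    proof
      fix g assume g: "g \<in> H - K"
      have "g = s \<circ> (inv' s \<circ> g)" using surj by (simp add: fun_eq_iff surj_f_inv_f)
      with HK[OF g] show "g \<in> (\<lambda>k. s \<circ> k) ` K" by blast
    qed
  qed (use KH in auto)
  moreover have "inj_on (\<lambda>k. s \<circ> k) K"
    using inj by (auto intro!: inj_onI simp: fun_eq_iff inj_eq)
  ultimately have "card (H - K) = card K" by (metis card_image)
  moreover have "card (H - K) = card H - card K" "card K \<le> card H"
    using fin sub by (auto intro: card_Diff_subset card_mono finite_subset)
  ultimately show ?thesis by linarith
qed

lemma finite_cent: "finite S \<Longrightarrow> finite (cent S x)"
  by (rule finite_subset[OF _ finite_permutations[of S]]) (auto simp: cent_def)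

lemma cent_inv_comp:
  assumes "s \<in> cent S x" "g \<in> cent S x"
  shows "inv' s \<circ> g \<in> cent S x"
proof -
  have s: "s permutes S" and c: "s (x z) = x (s z)" "g (x z) = x (g z)" for z
    using assms by (auto simp: cent_def fun_eq_iff)
  have "inv' s (x z) = x (inv' s z)" for z
    by (metis c(1) permutes_inverses[OF s])
  then show ?thesis
    using assms permutes_compose[OF _ permutes_inv[OF s]] by (auto simp: cent_def fun_eq_iff)
qed

lemma cent_comp:
  assumes "s \<in> cent S x" "g \<in> cent S x"
  shows "s \<circ> g \<in> cent S x"
  using assms by (auto simp: cent_def fun_eq_iff permutes_compose)

lemma card_cent_eq_twice_alt_cent:
  assumes "s \<in> cent {1..n} x" "\<not> evenperm s"
  shows "card (cent {1..n} x) = 2 * card (alt_cent n x)"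
proof (rule card_index_two[of _ _ s])
  have perm: "permutation g" if "g \<in> cent {1..n} x" for g
    using that permutation_permutes by (auto simp: cent_def)
  show "inj s" "surj s" using assms by (auto simp: cent_def intro: permutes_inj dest: permutes_surj)
  show "s \<circ> k \<in> cent {1..n} x - alt_cent n x" if "k \<in> alt_cent n x" for k
    using that assms cent_comp[of s _ x k] evenperm_comp[of s k] perm by (auto simp: alt_cent_def)
  show "inv' s \<circ> g \<in> alt_cent n x" if "g \<in> cent {1..n} x - alt_cent n x" for g
    using that assms cent_inv_comp[of s _ x g] evenperm_comp[of "inv' s" g] perm evenperm_inv[of s] 
      permutation_inverse[of s]
    by (auto simp: alt_cent_def)
qed (use assms in \<open>auto simp: alt_cent_def finite_cent\<close>)

text \<open>
  The even elements of a centralizer are all of it or exactly half of it. The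
  divisibility suffices wherever a factor 2 can be spared, and holds without exhibiting an odd
  element of the centralizer.
\<close>
lemma card_alt_cent_dvd_cent: 
  "card (alt_cent n x) dvd card (cent {1..n} x)"
proof (cases "alt_cent n x = cent {1..n} x")
  case False
  then obtain s where "s \<in> cent {1..n} x" "\<not> evenperm s" by (auto simp: alt_cent_def)
  then show ?thesis using card_cent_eq_twice_alt_cent by simp
qed simp

text \<open>
  The transposition of two points fixed by \<open>x\<close> is an odd element of the centralizer.
\<close>
lemma card_cent_eq_twice_alt_cent_fixes2:
  assumes "x permutes A" "A \<subseteq> {1..n}" "card A + 2 \<le> n"
  shows "card (cent {1..n} x) = 2 * card (alt_cent n x)"
proof -
  have "card ({1..n} - A) \<ge> 2"
    using assms finite_subset[OF assms(2)] by (simp add: card_Diff_subset)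
  then obtain w z where wz: "{w, z} \<subseteq> {1..n} - A" "w \<noteq> z"
    by (metis card_2_iff obtain_subset_with_card_n)
  have "Transposition.transpose w z permutes {w, z}" by (simp add: permutes_swap_id)
  then have "Transposition.transpose w z \<circ> x = x \<circ> Transposition.transpose w z"
    using disjoint_permutes_commute[OF _ assms(1)] wz by blast
  moreover have "Transposition.transpose w z permutes {1..n}"
    using wz by (intro permutes_swap_id) auto
  ultimately have "Transposition.transpose w z \<in> cent {1..n} x" by (simp add: cent_def)
  moreover have "\<not> evenperm (Transposition.transpose w z)" using wz by (simp add: evenperm_swap)
  ultimately show ?thesis by (rule card_cent_eq_twice_alt_cent)
qed

text \<open>
  By Bezout \<open>x\<close> itself is a power of \<open>x ^^ i\<close>, so a point fixed by the latter is fixed by \<open>x\<close>.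
\<close>
lemma prime_order_not_fixed:
  assumes "prime q" "x ^^ q = id" "x u \<noteq> u" "\<not> q dvd i"
  shows "(x ^^ i) u \<noteq> u"
proof
  assume fixed: "(x ^^ i) u = u"
  obtain s t where st: "i * s = Suc (q * t)" using bezout_prime assms by blast
  have "(x ^^ (i * s)) u = u"
    by (induction s) (simp_all add: funpow_add fixed)
  moreover have "(x ^^ (q * t)) = id" 
    using assms(2) by (metis funpow_mult id_funpow)
  ultimately show False using assms(3) st by simp
qed

text \<open>
  Hence on a moved point the powers of \<open>x\<close> are distinguished modulo \<open>q\<close>: all nontrivial orbits
  look alike, which is what makes it possible to permute them by elements of the centralizer.
\<close>
lemma funpow_eq_mod:
  assumes "prime q" "x ^^ q = id" "x u \<noteq> u" "bij x" "(x ^^ i) u = (x ^^ j) u"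
  shows "i mod q = j mod q"
proof -
  have *: "i mod q = j mod q" if "i \<le> j" "(x ^^ i) u = (x ^^ j) u" for i j
  proof -
    have "(x ^^ (j - i)) u = u" using funpow_diff[of x i j u] that assms(4) bij_is_inj by blast
    then have "q dvd (j - i)" using prime_order_not_fixed[OF assms(1-3)] by blast
    then show ?thesis using that(1) by (metis mod_eq_dvd_iff_nat)
  qed
  show ?thesis using *[of i j] *[of j i] assms(5) by (metis nat_le_linear)
qed

lemma funpow_mod_order:
  assumes "x ^^ q = id"
  shows "(x ^^ (i mod q)) = x ^^ i"
proof
  fix w
  have "(x ^^ q) w = w" using assms by simp
  then show "(x ^^ (i mod q)) w = (x ^^ i) w" by (simp add: funpow_mod_eq)
qed

lemma card_orbit_prime_order:
  assumes "prime q" "x ^^ q = id" "x u \<noteq> u" "bij x"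
  shows "card (orbit x u) = q"
proof -
  have "orbit x u = (\<lambda>i. (x ^^ i) u) ` {..<q}"
    using orbit_altdef_bounded[of q x u] assms prime_gt_0_nat by auto
  moreover have "inj_on (\<lambda>i. (x ^^ i) u) {..<q}"
    by (rule inj_onI) (use funpow_eq_mod[OF assms] in force)
  ultimately show ?thesis by (simp add: card_image)
qed

section \<open>Permutations of prime order\<close>

abbreviation moved :: "('a \<Rightarrow> 'a) \<Rightarrow> 'a set" where
  "moved x \<equiv> {z. x z \<noteq> z}"

locale prime_order_perm =
  fixes S :: "'a set" and x :: "'a \<Rightarrow> 'a" and q :: nat
  assumes fin: "finite S" and perm: "x permutes S" and prime: "prime q" and order: "x ^^ q = id"
begin

lemma permutation: "permutation x"
  using fin perm permutation_permutes by blast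

lemma bij: "bij x"
  using perm permutes_bij by blast

lemma orbit_eq: "z \<in> orbit x u \<Longrightarrow> orbit x z = orbit x u"
  using cyclic_on_orbit'[OF permutation] orbit_cyclic_eq3 by metis

lemma self_in: "u \<in> orbit x u"
  using permutation_self_in_orbit[OF permutation] .

lemma funpow_in: "(x ^^ i) u \<in> orbit x u"
  using funpow_in_orbit[OF self_in] .

lemma in_orbitE:
  assumes "z \<in> orbit x u" obtains i where "z = (x ^^ i) u"
  using in_orbit_funpow[OF permutation assms] by blast

lemma orbit_moved: "z \<in> orbit x u \<Longrightarrow> x u \<noteq> u \<Longrightarrow> x z \<noteq> z"
  by (metis orbit_eq orbit_eq_singleton_iff self_in singletonD)

lemma moved_subset: "moved x \<subseteq> S"
  using perm by (auto simp: permutes_def)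

lemma orbit_subset_moved: "x u \<noteq> u \<Longrightarrow> orbit x u \<subseteq> moved x"
  using orbit_moved by blast

lemma orbit_subset: "x u \<noteq> u \<Longrightarrow> orbit x u \<subseteq> S"
  using orbit_subset_moved moved_subset by blast

lemma card_orbit: "x u \<noteq> u \<Longrightarrow> card (orbit x u) = q"
  using card_orbit_prime_order[OF prime order _ bij] .

lemma restrict_permutes: "perm_restrict x (orbit x u) permutes orbit x u"
proof -
  have f: "finite (orbit x u)" using finite_orbit[OF self_in] .
  have "x ` orbit x u = orbit x u"
    by (rule endo_inj_surj[OF f]) (auto intro: orbit.step inj_on_subset[OF bij_is_inj[OF bij]])
  then have "bij_betw x (orbit x u) (orbit x u)"
    by (auto simp: bij_betw_def intro: inj_on_subset[OF bij_is_inj[OF bij]])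
  then have "bij_betw (perm_restrict x (orbit x u)) (orbit x u) (orbit x u)"
    by (rule bij_betw_cong[THEN iffD1, rotated]) (simp add: perm_restrict_def)
  then show ?thesis by (rule bij_imp_permutes) (simp add: perm_restrict_def)
qed

lemma restrict_cyclic: "cyclic_on (perm_restrict x (orbit x u)) (orbit x u)"
  using cyclic_on_orbit'[OF permutation] by (simp add: cyclic_on_perm_restrict)

text \<open>
  The independent sets are the partial transversals of the nontrivial orbits.
\<close>
definition independent :: "'a set \<Rightarrow> bool" where
  "independent U \<longleftrightarrow> (\<forall>u\<in>U. x u \<noteq> u) \<and> (\<forall>u\<in>U. \<forall>v\<in>U. v \<in> orbit x u \<longrightarrow> v = u)"

lemma independent_subset: "independent T \<Longrightarrow> U \<subseteq> T \<Longrightarrow> independent U"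
  by (auto simp: independent_def)

text \<open>
  Choose one point in each nontrivial orbit. The size of a transversal is the number of
  \<open>q\<close>-cycles of \<open>x\<close>.
\<close>
lemma exists_transversal:
  obtains T where "independent T" "moved x = (\<Union>u\<in>T. orbit x u)" "finite T"
proof -
  let ?M = "moved x"
  define r where "r z = (SOME w. w \<in> orbit x z)" for z
  define s where "s O' = (SOME w. w \<in> O')" for O' :: "'a set"
  have s: "s (orbit x z) \<in> orbit x z" for z
    unfolding s_def using someI[of "\<lambda>w. w \<in> orbit x z", OF self_in] .
  let ?T = "(\<lambda>z. s (orbit x z)) ` ?M"
  have "independent ?T"
    unfolding independent_def
  proof (intro conjI ballI impI)
    show "x u \<noteq> u" if "u \<in> ?T" for u using that s orbit_moved by blast
    show "v = u" if "u \<in> ?T" "v \<in> ?T" "v \<in> orbit x u" for u v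
    proof -
      from that obtain y z where "u = s (orbit x y)" "v = s (orbit x z)" by blast
      moreover have "orbit x u = orbit x y" "orbit x v = orbit x z"
        using orbit_eq s calculation by auto
      moreover have "orbit x v = orbit x u" using that orbit_eq by blast
      ultimately show ?thesis by simp
    qed
  qed
  moreover have "?M = (\<Union>u\<in>?T. orbit x u)"
  proof
    show "?M \<subseteq> (\<Union>u\<in>?T. orbit x u)" using orbit_eq[OF s] self_in by auto
    show "(\<Union>u\<in>?T. orbit x u) \<subseteq> ?M" using orbit_eq[OF s] orbit_moved by auto
  qed
  moreover have "finite ?T" using moved_subset fin finite_subset by blast
  ultimately show ?thesis using that by blast
qed

lemma card_Union_orbits:
  assumes "finite U" "independent U"
  shows "finite (\<Union>u\<in>U. orbit x u)" "card (\<Union>u\<in>U. orbit x u) = q * card U"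
proof -
  have f: "finite (orbit x u)" for u using finite_orbit[OF self_in] .
  then show "finite (\<Union>u\<in>U. orbit x u)" using assms by blast
  have "card (\<Union>u\<in>U. orbit x u) = (\<Sum>u\<in>U. card (orbit x u))"
  proof (rule card_UN_disjoint)
    show "\<forall>u\<in>U. \<forall>v\<in>U. u \<noteq> v \<longrightarrow> orbit x u \<inter> orbit x v = {}"
      using assms(2) orbit_eq self_in unfolding independent_def by (metis disjoint_iff)
  qed (use f assms in auto)
  also have "\<dots> = (\<Sum>u\<in>U. q)"
    using assms(2) card_orbit by (intro sum.cong) (auto simp: independent_def)
  finally show "card (\<Union>u\<in>U. orbit x u) = q * card U" by (simp add: mult.commute)
qed

text \<open>
  A map \<open>\<pi>\<close> of an independent set \<open>U\<close> extends to a map permuting the orbits of the points of \<open>U\<close> and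
  commuting with \<open>x\<close>, by sending the \<open>i\<close>-th iterate of \<open>u\<close> to the \<open>i\<close>-th iterate of \<open>\<pi> u\<close>. This
  embeds the permutations of \<open>U\<close> homomorphically into the centralizer of \<open>x\<close>.
\<close>
definition lift :: "'a set \<Rightarrow> ('a \<Rightarrow> 'a) \<Rightarrow> 'a \<Rightarrow> 'a" where
  "lift U \<pi> z = (if \<exists>u\<in>U. z \<in> orbit x u then
     let u = THE u. u \<in> U \<and> z \<in> orbit x u in (x ^^ (SOME i. z = (x ^^ i) u)) (\<pi> u) else z)"

lemma lift_outside: "z \<notin> (\<Union>u\<in>U. orbit x u) \<Longrightarrow> lift U \<pi> z = z"
  by (auto simp: lift_def)

text \<open>
  The extension is well defined because the exponent \<open>i\<close> is determined by the point modulo \<open>q\<close>,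
  while its effect on the target orbit also depends only on \<open>i\<close> modulo \<open>q\<close>.
\<close>
lemma lift_apply:
  assumes "independent U" "u \<in> U"
  shows "lift U \<pi> ((x ^^ i) u) = (x ^^ i) (\<pi> u)"
proof -
  let ?z = "(x ^^ i) u"
  have z: "?z \<in> orbit x u" by (rule funpow_in)
  have "(THE u. u \<in> U \<and> ?z \<in> orbit x u) = u"
  proof (rule the_equality)
    fix v assume "v \<in> U \<and> ?z \<in> orbit x v"
    then show "v = u" using assms z orbit_eq self_in unfolding independent_def by metis
  qed (use z assms in auto)
  moreover have "(x ^^ (SOME j. ?z = (x ^^ j) u)) = x ^^ i"
  proof -
    have "?z = (x ^^ (SOME j. ?z = (x ^^ j) u)) u"
      by (rule someI[of "\<lambda>j. ?z = (x ^^ j) u" i]) simp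
    moreover have "x u \<noteq> u" using assms by (simp add: independent_def)
    ultimately have "i mod q = (SOME j. ?z = (x ^^ j) u) mod q"
      by (intro funpow_eq_mod[OF prime order _ bij])
    then show ?thesis by (metis funpow_mod_order[OF order])
  qed
  ultimately show ?thesis using z assms(2) by (auto simp: lift_def Let_def)
qed

lemma lift_eqI:
  assumes "independent U"
    and "\<And>u i. u \<in> U \<Longrightarrow> f ((x ^^ i) u) = g ((x ^^ i) u)"
    and "\<And>z. z \<notin> (\<Union>u\<in>U. orbit x u) \<Longrightarrow> f z = g z"
  shows "f = g"
proof
  fix z show "f z = g z"
    using assms(2,3)[of _ ] in_orbitE by (cases "z \<in> (\<Union>u\<in>U. orbit x u)") blast+
qed

lemma lift_comp:
  assumes "independent U" "\<sigma> permutes U"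
  shows "lift U \<pi> \<circ> lift U \<sigma> = lift U (\<pi> \<circ> \<sigma>)"
proof (rule lift_eqI[OF assms(1)])
  fix u i assume "u \<in> U"
  then show "(lift U \<pi> \<circ> lift U \<sigma>) ((x ^^ i) u) = lift U (\<pi> \<circ> \<sigma>) ((x ^^ i) u)"
    using assms permutes_in_image[OF assms(2)] by (simp add: lift_apply)
next
  fix z assume "z \<notin> (\<Union>u\<in>U. orbit x u)"
  from lift_outside[OF this] show "(lift U \<pi> \<circ> lift U \<sigma>) z = lift U (\<pi> \<circ> \<sigma>) z" by simp
qed

lemma lift_id: "independent U \<Longrightarrow> lift U id = id"
  by (rule lift_eqI[of U]) (auto simp: lift_apply lift_outside)

lemma lift_power:
  assumes "independent U" "\<pi> permutes U"
  shows "(lift U \<pi>) ^^ k = lift U (\<pi> ^^ k)"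
  by (induction k) (simp_all only: funpow.simps lift_id assms lift_comp permutes_funpow)

lemma lift_permutes:
  assumes "independent U" "\<pi> permutes U"
  shows "lift U \<pi> permutes (\<Union>u\<in>U. orbit x u)"
proof -
  have "lift U \<pi> \<circ> lift U (inv' \<pi>) = id" "lift U (inv' \<pi>) \<circ> lift U \<pi> = id"
    using lift_comp[OF assms(1)] assms permutes_inv[OF assms(2)] permutes_inv_o[OF assms(2)] lift_id
    by auto
  then have "bij (lift U \<pi>)" using o_bij by blast
  then show ?thesis using lift_outside by (auto simp: permutes_def bij_iff)
qed

lemma lift_commute:
  assumes "independent U"
  shows "lift U \<pi> \<circ> x = x \<circ> lift U \<pi>"
proof (rule lift_eqI[OF assms(1)])
  fix u i assume "u \<in> U"
  then show "(lift U \<pi> \<circ> x) ((x ^^ i) u) = (x \<circ> lift U \<pi>) ((x ^^ i) u)"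
    using lift_apply[OF assms, of u \<pi> "Suc i"] lift_apply[OF assms, of u \<pi> i] by simp
next
  fix z assume z: "z \<notin> (\<Union>u\<in>U. orbit x u)"
  have "x z \<notin> (\<Union>u\<in>U. orbit x u)"
  proof
    assume "x z \<in> (\<Union>u\<in>U. orbit x u)"
    then obtain u where "u \<in> U" "x z \<in> orbit x u" by blast
    moreover have "x z \<in> orbit x z" by (rule orbit.base)
    ultimately have "z \<in> orbit x u" using orbit_eq self_in by metis
    with z \<open>u \<in> U\<close> show False by blast
  qed
  from lift_outside[OF this] lift_outside[OF z] show "(lift U \<pi> \<circ> x) z = (x \<circ> lift U \<pi>) z" by simp
qed

lemma lift_permutes_S:
  assumes "independent U" "\<pi> permutes U"
  shows "lift U \<pi> permutes S"
  using permutes_subset[OF lift_permutes[OF assms]] orbit_subset assms(1)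
  unfolding independent_def by (metis UN_least)

text \<open>
  Three cycles of equal length merge into one long cycle: go around the three orbits with a
  rotation, and advance by \<open>x\<close> once per round. After three steps every point has advanced by
  exactly one step of \<open>x\<close>.
\<close>
lemma cube_root:
  assumes ind: "independent {u, v, w}" and dist: "distinct [u, v, w]"
    and cover: "moved x = (\<Union>u\<in>{u, v, w}. orbit x u)"
  obtains y where "y permutes moved x" "cyclic_on y (moved x)" "y ^^ 3 = x"
proof -
  let ?M = "moved x" and ?c = "cycle_of_list [u, v, w]" and ?U = "{u, v, w}"
  have c: "?c permutes ?U" using cycle_permutes[of "[u,v,w]"] by simp
  have cval: "?c u = v" "?c v = w" "?c w = u" using dist by (auto simp: transpose_def)
  define a where "a = perm_restrict x (orbit x u)"
  define y where "y = lift ?U ?c \<circ> a"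
  have disj: "z \<notin> orbit x u" if "z \<in> orbit x v \<or> z \<in> orbit x w" for z
    using ind dist that orbit_eq self_in unfolding independent_def
    by (metis distinct_length_2_or_more insertI1 insertI2)
  \<comment> \<open>\<open>y\<close> carries the orbits of \<open>u\<close>, \<open>v\<close>, \<open>w\<close> cyclically onto each other, with one extra step of \<open>x\<close>
    on leaving the first\<close>
  have yu: "y ((x ^^ i) u) = (x ^^ Suc i) v" for i
    using lift_apply[OF ind, of u ?c "Suc i"] funpow_in[of i u] cval
    by (simp add: y_def a_def perm_restrict_def)
  have yv: "y ((x ^^ i) v) = (x ^^ i) w" for i
    using lift_apply[OF ind, of v ?c i] disj[of "(x ^^ i) v"] funpow_in[of i v] cval
    by (simp add: y_def a_def perm_restrict_def)
  have yw: "y ((x ^^ i) w) = (x ^^ i) u" for i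
    using lift_apply[OF ind, of w ?c i] disj[of "(x ^^ i) w"] funpow_in[of i w] cval
    by (simp add: y_def a_def perm_restrict_def)
  have yout: "y z = z" if "z \<notin> (\<Union>u\<in>?U. orbit x u)" for z
    using lift_outside[OF that] that by (simp add: y_def a_def perm_restrict_def)
  have "y permutes ?M"
    unfolding y_def cover
  proof (rule permutes_compose)
    show "a permutes (\<Union>u\<in>?U. orbit x u)"
      unfolding a_def by (rule permutes_subset[OF restrict_permutes]) auto
    show "lift ?U ?c permutes (\<Union>u\<in>?U. orbit x u)" using ind c by (rule lift_permutes)
  qed
  moreover have y3: "y ^^ 3 = x"
  proof (rule lift_eqI[OF ind])
    fix t i assume "t \<in> ?U"
    then consider "t = u" | "t = v" | "t = w" by blast
    then show "(y ^^ 3) ((x ^^ i) t) = x ((x ^^ i) t)"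
      using yu[of i] yv[of i] yv[of "Suc i"] yw[of i] yw[of "Suc i"] by cases (simp_all add: numeral_3_eq_3)
  next
    fix z assume z: "z \<notin> (\<Union>u\<in>?U. orbit x u)"
    then have "x z = z" using cover by blast
    then show "(y ^^ 3) z = x z" using yout[OF z] by (simp add: numeral_3_eq_3)
  qed
  moreover have "cyclic_on y ?M"
  proof -
    let ?O = "orbit y u"
    have permy: "permutation y"
      using \<open>y permutes ?M\<close> finite_subset[OF moved_subset fin] permutation_permutes by blast
    have step: "y z \<in> ?O" if "z \<in> ?O" for z using that by (rule orbit.step)
    have xstep: "x z \<in> ?O" if "z \<in> ?O" for z
      using step[OF step[OF step[OF that]]] y3 by (metis comp_apply funpow.simps id_apply numeral_3_eq_3)
    have xpow: "(x ^^ i) z \<in> ?O" if "z \<in> ?O" for z i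
      using that by (induction i) (auto intro: xstep)
    have u: "u \<in> ?O" using permutation_self_in_orbit[OF permy] .
    have "x v \<in> ?O" using step[OF u] yu[of 0] by simp
    \<comment> \<open>only \<open>x v\<close>, not \<open>v\<close>, is reached in one step; going around the cycle of \<open>x\<close> gives \<open>v\<close>\<close>
    then have "(x ^^ (q - 1)) (x v) \<in> ?O" by (rule xpow)
    moreover have "(x ^^ (q - 1)) (x v) = (x ^^ q) v"
      using prime_gt_0_nat[OF prime] by (metis comp_apply funpow_Suc_right Suc_diff_1)
    ultimately have v: "v \<in> ?O" using order by simp
    then have w: "w \<in> ?O" using step[OF v] yv[of 0] by simp
    have "?M = ?O"
    proof
      show "?M \<subseteq> ?O" unfolding cover using u v w xpow by (auto elim!: in_orbitE)
      have "u \<in> ?M" using ind by (simp add: independent_def)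
      then show "?O \<subseteq> ?M" using permutes_orbit_subset[OF \<open>y permutes ?M\<close>] by blast
    qed
    with u show ?thesis by (auto intro: cyclic_on_singleI)
  qed
  ultimately show ?thesis using that by blast
qed

text \<open>
  An element of the centralizer of \<open>x\<close> permutes the two nontrivial orbits. Those that fix both
  orbits are the permutations commuting with both cycles, and the others, if there are any, form
  a single coset of these.
\<close>
lemma card_cent_two_orbits:
  assumes ind: "independent {u, v}" and "u \<noteq> v"
    and cover: "moved x = orbit x u \<union> orbit x v"
  shows "card (cent S x) dvd 2 * (q * (q * fact (card S - q - q)))"
proof -
  let ?A = "orbit x u" and ?B = "orbit x v"
  let ?a = "perm_restrict x ?A" and ?b = "perm_restrict x ?B"
  have mv: "x u \<noteq> u" "x v \<noteq> v" using ind by (auto simp: independent_def)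
  have disj: "?A \<inter> ?B = {}" using ind \<open>u \<noteq> v\<close> orbit_eq self_in unfolding independent_def
    by (metis disjoint_iff insertI1 insertI2)
  define K where "K = cent S ?a \<inter> cent S ?b"
  have q2: "q \<ge> 2" using prime prime_ge_2_nat by blast
  have cardK: "card K = q * (q * fact (card S - q - q))"
    using card_cent_two_cyclic[OF fin orbit_subset[OF mv(1)] restrict_permutes restrict_cyclic _
        orbit_subset[OF mv(2)] restrict_permutes restrict_cyclic _ disj] q2 card_orbit mv
    by (simp add: K_def)
  have x: "x z = ?a (?b z)" for z
    using disj cover by (cases "z \<in> ?B"; cases "z \<in> ?A") (auto simp: perm_restrict_def intro: orbit.step)
  have sub: "K \<subseteq> cent S x"
  proof
    fix g assume "g \<in> K"
    then have g: "g permutes S" "g (?a z) = ?a (g z)" "g (?b z) = ?b (g z)" for z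
      by (auto simp: K_def cent_def fun_eq_iff)
    have "g (x z) = x (g z)" for z by (simp only: x g)
    with g(1) show "g \<in> cent S x" by (simp add: cent_def fun_eq_iff)
  qed
  have stepA: "x z \<in> ?A \<longleftrightarrow> z \<in> ?A" for z
    using orbit_eq self_in permutation_orbit_step[OF permutation, of z] by (metis orbit.base)
  have stepB: "x z \<in> ?B \<longleftrightarrow> z \<in> ?B" for z
    using orbit_eq self_in permutation_orbit_step[OF permutation, of z] by (metis orbit.base)
  have com: "g ((x ^^ i) z) = (x ^^ i) (g z)" if "g \<in> cent S x" for g z i
    using that funpow_commute by (auto simp: cent_def)
  have powA: "(x ^^ i) z \<in> ?A \<longleftrightarrow> z \<in> ?A" for z i
    by (induction i) (auto simp: stepA)
  have powB: "(x ^^ i) z \<in> ?B \<longleftrightarrow> z \<in> ?B" for z i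
    by (induction i) (auto simp: stepB)
  have moved: "g z \<in> ?A \<union> ?B \<longleftrightarrow> z \<in> ?A \<union> ?B" if "g \<in> cent S x" for g z
  proof -
    have "inj g" "g (x z) = x (g z)" using that permutes_inj by (auto simp: cent_def fun_eq_iff)
    then have "x (g z) = g z \<longleftrightarrow> x z = z" by (metis injD)
    then show ?thesis using cover by auto
  qed
  \<comment> \<open>the image of the single point \<open>u\<close> decides whether \<open>g\<close> swaps the orbits\<close>
  have mem: "g \<in> K \<longleftrightarrow> g u \<in> ?A" if g: "g \<in> cent S x" for g
  proof
    assume "g \<in> K"
    then have "g (?a u) = ?a (g u)" "inj g" 
      using permutes_inj by (auto simp: K_def cent_def fun_eq_iff)
    moreover have "?a u \<noteq> u" using mv self_in by (simp add: perm_restrict_def)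
    ultimately have "?a (g u) \<noteq> g u" by (metis injD)
    then show "g u \<in> ?A" by (auto simp: perm_restrict_def split: if_splits)
  next
    assume "g u \<in> ?A"
    then have A1: "g z \<in> ?A" if "z \<in> ?A" for z using that com[OF g] powA by (metis in_orbitE)
    have inj: "inj g" using g permutes_inj by (auto simp: cent_def)
    have "g ` ?A = ?A"
      by (rule endo_inj_surj) (use A1 inj finite_orbit[OF self_in] in \<open>auto intro: inj_on_subset\<close>)
    then have A: "g z \<in> ?A \<longleftrightarrow> z \<in> ?A" for z using inj by (metis image_iff injD)
    then have B: "g z \<in> ?B \<longleftrightarrow> z \<in> ?B" for z using moved[OF g, of z] disj by blast
    have "g permutes S" "g (x z) = x (g z)" for z using g by (auto simp: cent_def fun_eq_iff)
    then show "g \<in> K" by (auto simp: K_def cent_def fun_eq_iff perm_restrict_def A B)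
  qed
  show ?thesis
  proof (cases "cent S x = K")
    case True
    then show ?thesis using cardK by simp
  next
    case False
    then obtain s where s: "s \<in> cent S x" "s \<notin> K" using sub by blast
    have notK: "g \<in> cent S x - K \<longleftrightarrow> g \<in> cent S x \<and> g u \<in> ?B" for g
      using mem[of g] moved[of g u] disj self_in[of u] by blast
    have "s u \<in> ?B" using notK s by blast
    have sperm: "s permutes S" using s by (simp add: cent_def)
    have "card (cent S x) = 2 * card K"
    proof (rule card_index_two[OF _ sub])
      show "finite (cent S x)" using finite_cent fin by blast
      show "s \<in> cent S x - K" "inj s" "surj s"
        using s permutes_inj[OF sperm] permutes_surj[OF sperm] by auto
      fix k assume k: "k \<in> K"
      then have "k \<in> cent S x" "k u \<in> ?A" using sub mem by auto
      then obtain i where "k u = (x ^^ i) u" using in_orbitE by blast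
      then have "s (k u) = (x ^^ i) (s u)" using com s by simp
      then have "s (k u) \<in> ?B" using powB \<open>s u \<in> ?B\<close> by simp
      then show "s \<circ> k \<in> cent S x - K"
        using notK[of "s \<circ> k"] cent_comp[OF s(1) \<open>k \<in> cent S x\<close>] by simp
    next
      fix g assume g: "g \<in> cent S x - K"
      then have "g u \<in> ?B" using notK by blast
      then have "g u \<in> orbit x (s u)" using orbit_eq[OF \<open>s u \<in> ?B\<close>] by simp
      then obtain i where "g u = (x ^^ i) (s u)" using in_orbitE by blast
      then have "g u = s ((x ^^ i) u)" using com s by simp
      then have "inv' s (g u) = (x ^^ i) u" using permutes_inverses(2)[OF sperm] by simp
      then have "inv' s (g u) \<in> ?A" using funpow_in by simp
      moreover have "inv' s \<circ> g \<in> cent S x" using cent_inv_comp s g by blast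
      ultimately show "inv' s \<circ> g \<in> K" using mem by simp
    qed
    then show ?thesis using cardK by simp
  qed
qed

end

context prime_order_perm
begin

lemma exists_orbits_cover:
  assumes "x \<noteq> id"
  obtains T where "independent T" "moved x = (\<Union>u\<in>T. orbit x u)" "finite T" "T \<noteq> {}"
    "card (moved x) = q * card T"
proof -
  obtain T where T: "independent T" "moved x = (\<Union>u\<in>T. orbit x u)" "finite T"
    by (rule exists_transversal)
  have "T \<noteq> {}" using T(2) assms by (auto simp: fun_eq_iff)
  with T show ?thesis using that card_Union_orbits(2)[OF T(3,1)] by simp
qed

lemma one_orbit:
  assumes "x \<noteq> id" "card (moved x) < 2 * q"
  obtains u where "x u \<noteq> u" "moved x = orbit x u"
proof -
  obtain T where T: "independent T" "moved x = (\<Union>u\<in>T. orbit x u)" "finite T" "T \<noteq> {}"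
    "card (moved x) = q * card T"
    using exists_orbits_cover[OF assms(1)] .
  have "card T < 2" using assms(2) T(5) by simp
  moreover have "card T > 0" using T by (simp add: card_gt_0_iff)
  ultimately have "card T = 1" by linarith
  then obtain u where "T = {u}" by (rule card_1_singletonE)
  then have "x u \<noteq> u" "moved x = orbit x u" using T(1,2) by (simp_all add: independent_def)
  then show ?thesis using that by blast
qed

lemma permutes_one_orbit:
  assumes "moved x = orbit x u"
  shows "x permutes orbit x u" "cyclic_on x (orbit x u)"
proof -
  have "perm_restrict x (orbit x u) = x"
  proof
    fix z
    have "z \<in> orbit x u \<or> x z = z" using assms by blast
    then show "perm_restrict x (orbit x u) z = x z" by (auto simp: perm_restrict_def)
  qed
  then show "x permutes orbit x u" "cyclic_on x (orbit x u)"
    using restrict_permutes[of u] restrict_cyclic[of u] by auto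
qed

lemma card_cent_one_orbit:
  assumes "x \<noteq> id" "card (moved x) < 2 * q"
  shows "card (cent S x) = q * fact (card S - q)" 
proof -
  obtain u where u: "x u \<noteq> u" "moved x = orbit x u" using one_orbit[OF assms] .
  show ?thesis
    using card_cent_cyclic[OF fin orbit_subset[OF u(1)] permutes_one_orbit[OF u(2)]] card_orbit[OF u(1)]
      prime_ge_2_nat[OF prime] by simp
qed

lemma eq_cycle_of_list:
  assumes "x u \<noteq> u" "moved x = orbit x u"
  defines "cs \<equiv> map (\<lambda>i. (x ^^ i) u) [0..<q]"
  shows "distinct cs" "set cs = orbit x u" "length cs = q" "x = cycle_of_list cs"
proof -
  have q: "q > 0" using prime prime_gt_0_nat by blast
  have "inj_on (\<lambda>i. (x ^^ i) u) {..<q}"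
    by (rule inj_onI) (use funpow_eq_mod[OF prime order assms(1) bij] in force)
  then show d: "distinct cs" by (simp add: cs_def distinct_map atLeast0LessThan)
  show l: "length cs = q" by (simp add: cs_def)
  show set: "set cs = orbit x u"
    using orbit_altdef_bounded[of q x u] order q by (auto simp: cs_def)
  show "x = cycle_of_list cs"
  proof
    fix z
    show "x z = cycle_of_list cs z"
    proof (cases "z \<in> set cs")
      case False
      then have "x z = z" using set assms(2) by blast
      then show ?thesis using id_outside_supp[OF False] by simp
    next
      case True
      then obtain i where i: "i < q" "z = cs ! i" using l by (metis in_set_conv_nth)
      have "cycle_of_list cs z = map (cycle_of_list cs) cs ! i" using i l by simp
      also have "map (cycle_of_list cs) cs = rotate1 cs"
        using cyclic_rotation[OF d, of 1] by simp
      also have "rotate1 cs ! i = cs ! (Suc i mod q)" using i l by (simp add: nth_rotate1)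
      also have "\<dots> = (x ^^ (Suc i mod q)) u" using q by (simp add: cs_def)
      also have "\<dots> = x z" using i funpow_mod_order[OF order, of "Suc i"] by (simp add: cs_def)
      finally show ?thesis by simp
    qed
  qed
qed

end

section \<open>Cycles of prime length at least n - 2\<close>

lemma alt_cent_iff: "h \<in> alt_cent n g \<longleftrightarrow> h \<in> alt n \<and> h \<circ> g = g \<circ> h"
  by (auto simp: alt_cent_def cent_def alt_group_carrier)

lemma alt_comp: "g \<in> alt n \<Longrightarrow> h \<in> alt n \<Longrightarrow> g \<circ> h \<in> alt n"
  using group.is_monoid[OF alt_group_is_group, of n] monoid.m_closed[of "alt_group n" g h]
  by (simp add: alt_group_mult)

lemma alt_id: "id \<in> alt n"
  by (simp add: alt_group_carrier permutes_id)

lemma alt_funpow: "g \<in> alt n \<Longrightarrow> g ^^ k \<in> alt n"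
  by (induction k) (simp_all only: funpow.simps alt_id alt_comp)

lemma alt_cent_funpow_subset: "alt_cent n g \<subseteq> alt_cent n (g ^^ k)"
proof
  fix h assume "h \<in> alt_cent n g"
  then have h: "h \<in> alt n" "h \<circ> g = g \<circ> h" by (auto simp: alt_cent_iff)
  then show "h \<in> alt_cent n (g ^^ k)"
    using funpow_commute[OF h(2)] by (auto simp: alt_cent_iff fun_eq_iff)
qed

lemma alt_prime_order_perm:
  "g permutes {1..n::nat} \<Longrightarrow> prime q \<Longrightarrow> g ^^ q = id \<Longrightarrow> prime_order_perm {1..n} g q"
  by (rule prime_order_perm.intro) auto

text \<open>
  Lagrange's theorem, with the group power written as functional iteration.
\<close>
lemma funpow_eq_id_of_order:
  assumes H: "subgroup H (alt_group n)" and h: "h \<in> H"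
  shows "h ^^ card H = id"
proof -
  interpret H: group "(alt_group n)\<lparr>carrier := H\<rparr>"
    using group.subgroup_imp_group[OF alt_group_is_group H] .
  have "h [^]\<^bsub>(alt_group n)\<lparr>carrier := H\<rparr>\<^esub> k = h ^^ k" for k :: nat
    by (induction k) (simp_all add: alt_group_mult alt_group_one funpow_swap1 fun_eq_iff)
  then show ?thesis
    using H.pow_order_eq_1[of h] h by (simp add: order_def alt_group_one)
qed

lemma Cauchy_alt_cent:
  assumes g: "g \<in> alt n" and p: "prime p" "p dvd card (alt_cent n g)"
  obtains h where "h \<in> alt_cent n g" "h \<noteq> id" "h ^^ p = id"
proof -
  let ?C = "alt_cent n g" and ?A = "alt_group n"
  have sub: "subgroup ?C ?A" by (rule alt_cent_subgroup[OF g])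
  have grp: "group (?A\<lparr>carrier := ?C\<rparr>)"
    using group.subgroup_imp_group[OF alt_group_is_group sub] .
  obtain m where m: "card ?C = p * m" using p by blast
  have "\<exists>H. subgroup H (?A\<lparr>carrier := ?C\<rparr>) \<and> card H = p ^ 1"
    using sylow_thm[OF p(1) grp, of 1 m] m finite_alt_cent by (simp add: order_def)
  then obtain H where H: "subgroup H (?A\<lparr>carrier := ?C\<rparr>)" "card H = p" by auto
  have HA: "subgroup H ?A"
    using group.incl_subgroup[OF alt_group_is_group sub H(1)] .
  have "H \<subseteq> ?C" using subgroup.subset[OF H(1)] by simp
  have "card H > 1" using H prime_gt_1_nat[OF p(1)] by simp
  then obtain h where "h \<in> H" "h \<noteq> id"
    by (metis card_eq_0_iff card_le_Suc0_iff_eq less_le_not_le not_one_less_zero One_nat_def)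
  then show ?thesis using that \<open>H \<subseteq> ?C\<close> funpow_eq_id_of_order[OF HA] H by blast
qed

lemma div_vertex_eqI:
  assumes "g \<in> alt n" "h \<in> alt n" "card (alt_cent n g) = card (alt_cent n h)"
  shows "div_vertex (alt_group n) g = div_vertex (alt_group n) h"
  using div_vertex_dvd_iff[OF assms(1,2)] div_vertex_dvd_iff[OF assms(2,1)] assms(3) by (simp add: dvd_antisym)

lemma card_alt_cent_gt_1:
  assumes "g \<in> alt n" "g \<noteq> id"
  shows "card (alt_cent n g) > 1"
proof -
  have "{id, g} \<subseteq> alt_cent n g" using assms alt_id by (auto simp: alt_cent_iff)
  then have "card {id, g} \<le> card (alt_cent n g)" using finite_alt_cent card_mono by blast
  then show ?thesis using assms by simp
qed

text \<open>
  Fewer than \<open>2 p\<close> points leave room for only one nontrivial orbit, so \<open>g\<close> is a \<open>p\<close>-cycle. The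
  centralizer in the symmetric group then has order \<open>p (n - p)!\<close> with \<open>n - p \<le> 2\<close>; for \<open>n - p = 2\<close>
  the transposition of the two fixed points is odd, which removes the factor \<open>2\<close>.
\<close>
lemma card_alt_cent_large_prime:
  assumes n: "n \<ge> 9" and g: "g permutes {1..n}" "g \<noteq> id" and p: "prime p" "p \<ge> n - 2" "g ^^ p = id"
  shows "g \<in> k_cycles n p" "card (alt_cent n g) = p"
proof -
  interpret prime_order_perm "{1..n}" g p using alt_prime_order_perm g p by blast
  have "card (moved g) \<le> n" using card_mono[OF fin moved_subset] by simp
  then have small: "card (moved g) < 2 * p" using n p by linarith
  obtain u where u: "g u \<noteq> u" "moved g = orbit g u" using one_orbit[OF g(2) small] .
  have "set (map (\<lambda>i. (g ^^ i) u) [0..<p]) \<subseteq> {1..n}"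
    using eq_cycle_of_list(2)[OF u] orbit_subset[OF u(1)] by simp
  then show "g \<in> k_cycles n p"
    unfolding k_cycles_def using eq_cycle_of_list[OF u] by blast
  have le: "p \<le> n" using \<open>card (moved g) \<le> n\<close> card_orbit[OF u(1)] u by simp
  have c: "card (cent {1..n} g) = p * fact (n - p)"
    using card_cent_one_orbit[OF g(2) small] by simp
  show "card (alt_cent n g) = p"
  proof (cases "n = p + 2")
    case True
    then have "card (cent {1..n} g) = 2 * card (alt_cent n g)"
      using card_cent_eq_twice_alt_cent_fixes2[OF permutes_one_orbit(1)[OF u(2)] orbit_subset[OF u(1)]]
        card_orbit[OF u(1)] by simp
    then show ?thesis using c True by (simp add: fact_2)
  next
    case False
    then have "n - p = 0 \<or> n - p = 1" using le p by linarith
    then have "card (cent {1..n} g) = p" using c by auto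
    then have "card (alt_cent n g) dvd p" using card_alt_cent_dvd_cent by metis
    moreover have "card (alt_cent n g) \<noteq> 1"
    proof -
      have "odd p" using p n prime_odd_nat by auto
      then have "evenperm g" using evenperm_odd_order[OF permutation order] by blast
      then show ?thesis using card_alt_cent_gt_1[of g n] g by (simp add: alt_group_carrier)
    qed
    ultimately show ?thesis using p(1) unfolding prime_nat_iff by blast
  qed
qed

text \<open>
  If \<open>|C(h)|\<close> and \<open>|C(g)| = p\<close> are comparable under divisibility, then \<open>|C(h)| = p\<close>: the one
  nonobvious case is that \<open>p\<close> divides \<open>|C(h)|\<close>, where Cauchy's theorem yields an element \<open>k\<close> of order
  \<open>p\<close> commuting with \<open>h\<close>, and then \<open>h\<close> belongs to the group \<open>C(k)\<close> of order \<open>p\<close>.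
\<close>
lemma isolated_large_prime:
  assumes n: "n \<ge> 9" and g: "g \<in> alt n" "g \<noteq> id" and p: "prime p" "p \<ge> n - 2" "g ^^ p = id"
  shows "isolated_vertex (div_graph (alt_group n)) (div_vertex (alt_group n) g)"
proof -
  let ?v = "div_vertex (alt_group n)" and ?D = "div_graph (alt_group n)"
  have V: "pverts ?D = ?v ` (alt n - {id})" using pverts_alt n by simp
  have cg: "card (alt_cent n h) = p" if "h \<in> alt n" "h \<noteq> id" "h ^^ p = id" for h
    using card_alt_cent_large_prime(2)[OF n] that p by (simp add: alt_group_carrier)
  have "?v h = ?v g" if h: "h \<in> alt n" "h \<noteq> id" and dvd: "?v h dvd ?v g \<or> ?v g dvd ?v h" for h
  proof -
    have "card (alt_cent n h) dvd p \<or> p dvd card (alt_cent n h)"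
      using dvd div_vertex_dvd_iff g h cg[OF g p(3)] by metis
    then have "card (alt_cent n h) = p"
    proof
      assume "card (alt_cent n h) dvd p"
      then show ?thesis using p(1) card_alt_cent_gt_1[OF h] by (auto simp: prime_nat_iff)
    next
      assume "p dvd card (alt_cent n h)"
      then obtain k where k: "k \<in> alt_cent n h" "k \<noteq> id" "k ^^ p = id"
        using Cauchy_alt_cent h(1) p(1) by blast
      then have "k \<in> alt n" "h \<in> alt_cent n k" using h by (auto simp: alt_cent_iff)
      then have "h ^^ p = id"
        using funpow_eq_id_of_order[OF alt_cent_subgroup] cg[of k] k by metis
      then show ?thesis using cg h by blast
    qed
    then show ?thesis using div_vertex_eqI cg[OF g p(3)] g h by metis
  qed
  then show ?thesis
    using g V by (auto simp: isolated_vertex_def div_graph_def Let_def)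
qed

text \<open>
  Take \<open>q\<close> a prime factor of the order \<open>N\<close> of \<open>g\<close>, and \<open>k = N / q\<close>.
\<close>
lemma exists_prime_order_power:
  assumes "permutation g" "g \<noteq> id"
  obtains q k where "prime q" "(g ^^ k) ^^ q = id" "g ^^ k \<noteq> id"
proof -
  define N where "N = (LEAST N. N > 0 \<and> g ^^ N = id)"
  obtain m where "g ^^ m = id" "m > 0" using permutation_is_nilpotent[OF assms(1)] .
  then have N: "N > 0" "g ^^ N = id"
    unfolding N_def using LeastI[of "\<lambda>N. N > 0 \<and> g ^^ N = id" m] by auto
  have least: "g ^^ k \<noteq> id" if "0 < k" "k < N" for k
    using not_less_Least[of k "\<lambda>N. N > 0 \<and> g ^^ N = id"] that N_def by auto
  have "N \<noteq> 1" using N assms(2) by auto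
  then obtain q where q: "prime q" "q dvd N" using prime_factor_nat by blast
  then obtain k where k: "N = q * k" by blast
  have "q > 1" using q prime_gt_1_nat by blast
  then have "0 < k" "k < N" using k N by auto
  then have "g ^^ k \<noteq> id" by (rule least)
  moreover have "(g ^^ k) ^^ q = id" using N k by (simp add: funpow_mult mult.commute)
  ultimately show ?thesis using that q by blast
qed

section \<open>Connecting elements of small prime order to a 3-cycle\<close>

lemma funpow_comp_commute:
  assumes "x \<circ> y = y \<circ> x"
  shows "(x \<circ> y) ^^ k = (x ^^ k) \<circ> (y ^^ k)"
proof (induction k)
  case (Suc k)
  have "y ((x ^^ k) z) = (x ^^ k) (y z)" for z by (rule funpow_commute[OF assms[symmetric]])
  with Suc show ?case by (simp add: fun_eq_iff)
qed simp

text \<open>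
  By Bezout some multiple of \<open>q\<close> is \<open>1\<close> modulo \<open>p\<close>; raising the product to this power kills \<open>y\<close>
  and keeps \<open>x\<close>.
\<close>
lemma power_of_commuting_comp:
  assumes "prime p" "prime q" "p \<noteq> q" "x ^^ p = id" "y ^^ q = id" "x \<circ> y = y \<circ> x"
  obtains k where "(x \<circ> y) ^^ k = x"
proof -
  have "\<not> p dvd q" using assms primes_dvd_imp_eq by blast
  then obtain s t where st: "q * s = Suc (p * t)" using bezout_prime assms by blast
  have "x ^^ (q * s) = x"
    using assms(4) by (simp add: st flip: funpow_mult)
  moreover have "y ^^ (q * s) = id" 
    using assms(5) by (simp flip: funpow_mult)
  ultimately have "(x \<circ> y) ^^ (q * s) = x" using funpow_comp_commute[OF assms(6)] by simp
  then show ?thesis using that by blast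
qed

lemma linked_power:
  assumes "n \<ge> 4" "g \<in> alt n" "g ^^ k \<noteq> id"
  shows "linked n g (g ^^ k)"
proof (rule linked_dvd)
  show "g \<noteq> id" using assms(3) by auto
  show "card (alt_cent n g) dvd card (alt_cent n (g ^^ k))"
    by (intro card_alt_cent_dvd alt_cent_funpow_subset assms alt_funpow)
qed (use assms alt_funpow in auto)

text \<open>
  Both elements are powers of their product, hence linked to it.
\<close>
lemma linked_commuting:
  assumes n: "n \<ge> 4" and x: "x \<in> alt n" "x \<noteq> id" "prime p" "x ^^ p = id"
    and y: "y \<in> alt n" "y \<noteq> id" "prime q" "y ^^ q = id" and "p \<noteq> q" "x \<circ> y = y \<circ> x"
  shows "linked n x y"
proof -
  obtain k where k: "(x \<circ> y) ^^ k = x" using power_of_commuting_comp assms by metis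
  obtain l where "(y \<circ> x) ^^ l = y" using power_of_commuting_comp assms by metis
  then have l: "(x \<circ> y) ^^ l = y" using assms by simp
  have "linked n (x \<circ> y) x"
    using linked_power[OF n alt_comp[OF x(1) y(1)], of k] x(2) unfolding k .
  moreover have "linked n (x \<circ> y) y"
    using linked_power[OF n alt_comp[OF x(1) y(1)], of l] y(2) unfolding l .
  ultimately show ?thesis using linked_sym linked_trans by metis
qed

lemma dvd_of_double:
  fixes c d N :: nat
  assumes "2 * c = N" "2 * d dvd N" shows "d dvd c"
  using assms by auto

lemma twice_card_alt_cent_cycle:
  assumes x: "x \<in> alt n" "prime q" "x ^^ q = id" "card (moved x) = q" and qn: "q + 2 \<le> n"
  shows "2 * card (alt_cent n x) = q * fact (n - q)"
proof -
  interpret prime_order_perm "{1..n}" x q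
    using alt_prime_order_perm x by (simp add: alt_group_carrier)
  have "x \<noteq> id" "card (moved x) < 2 * q" using x prime_gt_0_nat[of q] by auto
  then obtain u where u: "x u \<noteq> u" "moved x = orbit x u" using one_orbit by blast
  have "card (cent {1..n} x) = q * fact (n - q)"
    using card_cent_one_orbit[OF \<open>x \<noteq> id\<close> \<open>card (moved x) < 2 * q\<close>] by simp
  moreover have "card (cent {1..n} x) = 2 * card (alt_cent n x)"
    using card_cent_eq_twice_alt_cent_fixes2[OF permutes_one_orbit(1)[OF u(2)] orbit_subset[OF u(1)]]
      card_orbit[OF u(1)] qn by simp
  ultimately show ?thesis by simp
qed

text \<open>
  An intrinsic description of 3-cycles, which applies directly to a permutation that was not
  built from a list of points.
\<close>
definition three_cycle :: "nat \<Rightarrow> (nat \<Rightarrow> nat) \<Rightarrow> bool" where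
  "three_cycle n c \<longleftrightarrow> c \<in> alt n \<and> c ^^ 3 = id \<and> card (moved c) = 3"

lemma three_cycle_neq_id: "three_cycle n c \<Longrightarrow> c \<noteq> id"
  by (auto simp: three_cycle_def)

lemma twice_card_alt_cent_three_cycle:
  assumes "n \<ge> 5" "three_cycle n c"
  shows "2 * card (alt_cent n c) = 3 * fact (n - 3)"
  using twice_card_alt_cent_cycle[of c n 3] assms by (simp add: three_cycle_def)

lemma linked_three_cycles:
  assumes "n \<ge> 5" "three_cycle n c" "three_cycle n d"
  shows "linked n c d"
proof (rule linked_dvd)
  have "card (alt_cent n c) = card (alt_cent n d)"
    using twice_card_alt_cent_three_cycle[OF assms(1,2)] twice_card_alt_cent_three_cycle[OF assms(1,3)]
    by linarith
  then show "card (alt_cent n c) dvd card (alt_cent n d)" by simp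
qed (use assms three_cycle_neq_id in \<open>auto simp: three_cycle_def\<close>)

lemma three_cycle_cycle_of_list:
  assumes "distinct [a, b, c]" "{a, b, c} \<subseteq> {1..n}"
  shows "three_cycle n (cycle_of_list [a, b, c])"
proof -
  have "moved (cycle_of_list [a, b, c]) = {a, b, c}"
    using assms by (auto simp: transpose_def)
  then have "card (moved (cycle_of_list [a, b, c])) = 3" using assms by simp
  moreover have "cycle_of_list [a, b, c] ^^ 3 = id"
    using cycle_is_id_root[OF assms(1)] by (simp add: numeral_3_eq_3)
  ultimately show ?thesis
    using cycle_of_list_3_in_alt[OF assms] by (simp add: three_cycle_def)
qed

lemma linked_disjoint_three_cycle:
  assumes n: "n \<ge> 4" and x: "x \<in> alt n" "x \<noteq> id" "prime q" "x ^^ q = id" "q \<noteq> 3"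
    and few: "card (moved x) + 3 \<le> n"
  obtains c where "three_cycle n c" "linked n x c"
proof -
  have xp: "x permutes {1..n}" using x by (simp add: alt_group_carrier)
  have sub: "moved x \<subseteq> {1..n}" using xp by (auto simp: permutes_def)
  have "card ({1..n} - moved x) \<ge> 3"
    using few card_Diff_subset[OF finite_subset[OF sub] sub] by simp
  then obtain W where W: "W \<subseteq> {1..n} - moved x" "card W = 3"
    by (meson obtain_subset_with_card_n)
  then obtain a b c where abc: "W = {a, b, c}" "a \<noteq> b" "b \<noteq> c" "a \<noteq> c"
    by (auto simp: card_3_iff)
  let ?c = "cycle_of_list [a, b, c]"
  have c3: "three_cycle n ?c"
    using three_cycle_cycle_of_list[of a b c n] abc W by auto
  have "?c permutes W" using cycle_permutes[of "[a, b, c]"] abc by simp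
  moreover have "x permutes moved x"
    by (rule permutes_superset[OF xp]) simp
  moreover have "moved x \<inter> W = {}" using W by blast
  ultimately have "x \<circ> ?c = ?c \<circ> x" using disjoint_permutes_commute by blast
  then have "linked n x ?c"
    using linked_commuting[OF n x(1-4), of ?c 3] c3 x(5) three_cycle_neq_id[OF c3]
    by (simp add: three_cycle_def)
  with c3 show ?thesis using that by blast
qed

context prime_order_perm
begin

lemma lift_neq_id:
  assumes "independent U" "u \<in> U" "\<pi> u \<noteq> u"
  shows "lift U \<pi> \<noteq> id"
proof
  assume "lift U \<pi> = id"
  then have "lift U \<pi> u = u" by simp
  moreover have "lift U \<pi> u = \<pi> u" using lift_apply[OF assms(1,2), of \<pi> 0] by simp
  ultimately show False using assms(3) by simp
qed

lemma moved_lift_subset: "moved (lift U \<pi>) \<subseteq> (\<Union>u\<in>U. orbit x u)"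
  using lift_outside by blast

end

text \<open>
  Rotating three of the \<open>q\<close>-cycles of \<open>x\<close> commutes with \<open>x\<close> and has order 3. The bound on the
  number of moved points matters for \<open>q = 2\<close>, where it identifies the rotation as a product of at
  most two 3-cycles.
\<close>
lemma linked_rotation:
  assumes n: "n \<ge> 4" and x: "x \<in> alt n" "x \<noteq> id" and q: "q \<noteq> 3"
    and P: "prime_order_perm {1..n} x q"
    and U: "prime_order_perm.independent x U" "card U = 3"
  obtains r where "r \<in> alt n" "r \<noteq> id" "r ^^ 3 = id" "card (moved r) \<le> 3 * q" "linked n x r"
proof -
  interpret prime_order_perm "{1..n}" x q by (rule P)
  obtain a b c where abc: "U = {a, b, c}" "a \<noteq> b" "b \<noteq> c" "a \<noteq> c"
    using U(2) by (auto simp: card_3_iff)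
  let ?c = "cycle_of_list [a, b, c]"
  have c: "?c permutes U" using cycle_permutes[of "[a, b, c]"] abc by simp
  have c3: "?c ^^ 3 = id" using cycle_is_id_root[of "[a, b, c]"] abc by (simp add: numeral_3_eq_3)
  define r where "r = lift U ?c"
  have rp: "r permutes {1..n}" unfolding r_def by (rule lift_permutes_S[OF U(1) c])
  have r3: "r ^^ 3 = id" unfolding r_def by (simp only: lift_power[OF U(1) c] c3 lift_id[OF U(1)])
  have "evenperm r"
    using evenperm_odd_order[OF _ r3] rp fin permutation_permutes by auto
  then have alt: "r \<in> alt n" using rp by (simp add: alt_group_carrier)
  have "?c a \<noteq> a" using abc by (auto simp: transpose_def)
  then have rid: "r \<noteq> id" unfolding r_def using lift_neq_id[OF U(1), of a] abc by blast
  have "card (moved r) \<le> card (\<Union>u\<in>U. orbit x u)"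
    unfolding r_def by (intro card_mono moved_lift_subset card_Union_orbits) (use U abc in auto)
  also have "\<dots> = 3 * q" using card_Union_orbits(2)[of U] U abc by simp
  finally have "card (moved r) \<le> 3 * q" .
  moreover have "linked n x r"
    using linked_commuting[OF n x prime order alt rid _ r3 q] lift_commute[OF U(1), of ?c]
    by (simp add: r_def)
  ultimately show ?thesis using that alt rid r3 by blast
qed

text \<open>
  An even involution in the centralizer: the square of the extension of a 4-cycle on the four
  orbit representatives. As a square it is even, with no need to compute the sign of a swap of two
  \<open>q\<close>-cycles.
\<close>
lemma linked_double_swap:
  assumes n: "n \<ge> 4" and x: "x \<in> alt n" "x \<noteq> id" and q: "q \<noteq> 2"
    and P: "prime_order_perm {1..n} x q"
    and U: "prime_order_perm.independent x U" "card U = 4"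
  obtains s where "s \<in> alt n" "s \<noteq> id" "s ^^ 2 = id" "linked n x s"
proof -
  interpret prime_order_perm "{1..n}" x q by (rule P)
  obtain xs where xs: "set xs = U" "distinct xs" "length xs = 4"
    using finite_distinct_list[of U] U(2) by (metis card.infinite distinct_card zero_neq_numeral)
  let ?c = "cycle_of_list xs"
  have c: "?c permutes U" using cycle_permutes[of xs] xs by simp
  have c4: "?c ^^ 4 = id" using cycle_is_id_root[of xs] xs by simp
  define s where "s = lift U ?c ^^ 2"
  have s': "s = lift U (?c ^^ 2)" unfolding s_def by (rule lift_power[OF U(1) c])
  have sp: "s permutes {1..n}" unfolding s_def by (rule permutes_funpow[OF lift_permutes_S[OF U(1) c]])
  have "permutation (lift U ?c)" using lift_permutes_S[OF U(1) c] fin permutation_permutes by blast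
  then have "evenperm s" unfolding s_def using evenperm_square by (simp add: numeral_2_eq_2)
  then have alt: "s \<in> alt n" using sp by (simp add: alt_group_carrier)
  have "s ^^ 2 = lift U (?c ^^ 4)"
    unfolding s_def using lift_power[OF U(1) c, of 4] by (simp add: funpow_mult)
  then have s2: "s ^^ 2 = id" by (simp only: c4 lift_id[OF U(1)])
  have "(?c ^^ 2) (xs ! 0) = rotate 2 xs ! 0"
    using cyclic_rotation[OF xs(2), of 2] xs(3) by (metis nth_map zero_less_numeral)
  also have "\<dots> = xs ! 2" using xs(3) by (simp add: nth_rotate)
  finally have "(?c ^^ 2) (xs ! 0) \<noteq> xs ! 0" using xs by (simp add: nth_eq_iff_index_eq)
  then have sid: "s \<noteq> id" unfolding s' using lift_neq_id[OF U(1), of "xs ! 0"] xs by force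
  have "linked n x s"
    using linked_commuting[OF n x prime order alt sid _ s2 q] lift_commute[OF U(1), of "?c ^^ 2"]
    by (simp add: s')
  then show ?thesis using that alt sid s2 by blast
qed

text \<open>
  Let \<open>a\<close> be one of the two \<open>q\<close>-cycles of \<open>x\<close>. The order of \<open>C(x)\<close> divides \<open>2 q\<^sup>2 (n - 2q)!\<close> and
  \<open>|C(a)| = q (n - q)! / 2\<close>. As \<open>q! (n - 2q)!\<close> divides \<open>(n - q)!\<close>, it suffices that \<open>4 q\<close> divides \<open>q!\<close>,
  which is true for \<open>q \<ge> 5\<close>.
\<close>
lemma linked_two_orbits:
  assumes n: "n \<ge> 9" and x: "x \<in> alt n"  "x \<noteq> id"
    and P: "prime_order_perm {1..n} x q" and q: "q \<ge> 5"
    and U: "prime_order_perm.independent x {u, v}" "u \<noteq> v" "moved x = orbit x u \<union> orbit x v"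
  obtains a where "a \<in> alt n" "a \<noteq> id" "a ^^ q = id" "card (moved a) = q" "linked n x a" "2 * q \<le> n"
proof -
  interpret prime_order_perm "{1..n}" x q by (rule P)
  let ?a = "perm_restrict x (orbit x u)"
  have mv: "x u \<noteq> u" using U by (simp add: independent_def)
  have "card (moved x) = 2 * q" using card_Union_orbits(2)[of "{u, v}"] U by simp
  then have qn: "2 * q \<le> n" using card_mono[OF fin moved_subset] by simp
  have aq: "?a ^^ q = id"
  proof
    fix z
    have "(?a ^^ k) z = (if z \<in> orbit x u then (x ^^ k) z else z)" for k
    proof (induction k)
      case (Suc k)
      have "(x ^^ k) z \<in> orbit x u" if "z \<in> orbit x u" using that by (rule funpow_in_orbit)
      with Suc show ?case by (auto simp: perm_restrict_def)
    qed simp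
    then show "(?a ^^ q) z = id z" using order by simp
  qed
  have ap: "?a permutes {1..n}" using permutes_subset[OF restrict_permutes orbit_subset[OF mv]] .
  have "odd q" using q prime prime_odd_nat by auto
  then have "evenperm ?a" using evenperm_odd_order[OF _ aq] ap fin permutation_permutes by blast
  then have alt: "?a \<in> alt n" using ap by (simp add: alt_group_carrier)
  have "moved ?a = orbit x u" using orbit_moved mv by (auto simp: perm_restrict_def)
  then have card: "card (moved ?a) = q" using card_orbit[OF mv] by simp
  then have aid: "?a \<noteq> id" using q by auto
  have ca: "2 * card (alt_cent n ?a) = q * fact (n - q)"
    using twice_card_alt_cent_cycle[OF alt prime aq card] qn q by simp
  have "card (alt_cent n x) dvd 2 * (q * (q * fact (n - q - q)))"
    using card_alt_cent_dvd_cent card_cent_two_orbits[OF U] by (metis card_atLeastAtMost diff_Suc_1 dvd_trans)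
  also have "\<dots> dvd card (alt_cent n ?a)"
  proof (rule dvd_of_double[OF ca])
    have "4 dvd (fact (q - 1) :: nat)" using q by (intro dvd_fact) auto
    then have "q * 4 dvd q * fact (q - 1)" by (rule mult_dvd_mono[OF dvd_refl])
    also have "\<dots> = fact q" using q by (simp add: fact_reduce)
    finally have "(q * 4) * fact (n - q - q) dvd fact q * fact (n - q - q)" by (rule mult_dvd_mono) simp
    also have "\<dots> dvd fact (q + (n - q - q))" by (rule fact_fact_dvd_fact)
    also have "q + (n - q - q) = n - q" using qn by simp
    finally have "q * ((q * 4) * fact (n - q - q)) dvd q * fact (n - q)" by (rule mult_dvd_mono[OF dvd_refl])
    then show "2 * (2 * (q * (q * fact (n - q - q)))) dvd q * fact (n - q)" by (simp add: mult_ac)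
  qed
  finally have "linked n x ?a" using linked_dvd[of n x ?a] n x alt aid by simp
  then show ?thesis using that alt aid aq card qn by blast
qed

text \<open>
  Fewer than twelve moved points means at most three 3-cycles; these cases are settled by counting. For \<open>n = 9\<close> the
  centralizer of a product of three 3-cycles is a 3-group, so a commuting element of another prime
  order is not available; a 9-cycle takes its place.
\<close>
lemma linked_three_cycle_of_small_order_3:
  assumes n: "n \<ge> 9" and x: "x \<in> alt n" "x \<noteq> id" "x ^^ 3 = id" "card (moved x) < 12"
  obtains c where "three_cycle n c" "linked n x c"
proof -
  interpret prime_order_perm "{1..n}" x 3
    using alt_prime_order_perm x by (simp add: alt_group_carrier)
  define h where "h = cycle_of_list [1, 2, 3 :: nat]"
  have h: "three_cycle n h" unfolding h_def using n by (intro three_cycle_cycle_of_list) auto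
  have ch: "2 * card (alt_cent n h) = 3 * fact (n - 3)"
    using twice_card_alt_cent_three_cycle[OF _ h] n by simp
  have link: "linked n g h" if "g \<in> alt n" "g \<noteq> id" "card (alt_cent n g) dvd card (alt_cent n h)" for g
    using linked_dvd[of n g h] that n h three_cycle_neq_id[OF h] by (simp add: three_cycle_def)
  obtain T where T: "independent T" "moved x = (\<Union>u\<in>T. orbit x u)" "finite T" "T \<noteq> {}"
    "card (moved x) = 3 * card T"
    using exists_orbits_cover[OF x(2)] .
  have "card T < 4" "card T > 0" using T x by (auto simp: card_gt_0_iff)
  then consider "card T = 1" | "card T = 2" | "card T = 3" by linarith
  then have "\<exists>c. three_cycle n c \<and> linked n x c"
  proof cases
    case 1
    then have "three_cycle n x" using x T by (simp add: three_cycle_def)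
    moreover have "linked n x x" using linked_dvd x n by simp
    ultimately show ?thesis by blast
  next
    case 2
    then obtain u v where uv: "T = {u, v}" "u \<noteq> v" by (auto simp: card_2_iff)
    have "x permutes moved x" by (rule permutes_superset[OF perm]) simp
    moreover have "card (moved x) = 6" using T 2 by simp
    ultimately have two: "card (cent {1..n} x) = 2 * card (alt_cent n x)"
      using card_cent_eq_twice_alt_cent_fixes2[of x "moved x" n] moved_subset n by simp
    have "card (cent {1..n} x) dvd 2 * (3 * (3 * fact (n - 6)))"
      using card_cent_two_orbits[of u v] T uv by simp
    then have "card (alt_cent n x) dvd 9 * fact (n - 6)" unfolding two by simp
    also have "\<dots> dvd card (alt_cent n h)"
    proof (rule dvd_of_double[OF ch])
      have "fact 3 * fact (n - 6) dvd (fact (3 + (n - 6)) :: nat)" by (rule fact_fact_dvd_fact)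
      moreover have "3 + (n - 6) = n - 3" using n by simp
      ultimately have "3 * (6 * fact (n - 6)) dvd 3 * (fact (n - 3) :: nat)"
        by (simp add: fact_numeral)
      then show "2 * (9 * fact (n - 6)) dvd 3 * (fact (n - 3) :: nat)" by simp
    qed
    finally show ?thesis using link x h by blast
  next
    case 3
    then obtain u v w where uvw: "T = {u, v, w}" "distinct [u, v, w]" by (auto simp: card_3_iff)
    obtain y where y: "y permutes moved x" "cyclic_on y (moved x)" "y ^^ 3 = x"
      using cube_root[of u v w] T uvw by blast
    have yp: "y permutes {1..n}" using permutes_subset[OF y(1) moved_subset] .
    have "(y ^^ 3) ^^ 3 = id" using x y by simp
    then have "y ^^ 9 = id" by (simp add: funpow_mult)
    then have "evenperm y"
      by (rule evenperm_odd_order[rotated]) (use yp fin permutation_permutes in auto)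
    then have alt: "y \<in> alt n" using yp by (simp add: alt_group_carrier)
    have yid: "y \<noteq> id" using y x by auto
    have card9: "card (moved x) = 9" using T 3 by simp
    have "card (cent {1..n} y) = 9 * fact (n - 9)"
      using card_cent_cyclic[OF fin moved_subset y(1,2)] card9 by simp
    then have "card (alt_cent n y) dvd 9 * fact (n - 9)" using card_alt_cent_dvd_cent by metis
    also have "\<dots> dvd card (alt_cent n h)"
    proof (rule dvd_of_double[OF ch])
      have "6 * fact (n - 9) dvd fact 6 * (fact (n - 9) :: nat)"
        by (rule mult_dvd_mono[OF dvd_fact dvd_refl]) auto
      also have "\<dots> dvd fact (6 + (n - 9))" by (rule fact_fact_dvd_fact)
      also have "6 + (n - 9) = n - 3" using n by simp
      finally have "3 * (6 * fact (n - 9)) dvd 3 * (fact (n - 3) :: nat)" by (rule mult_dvd_mono[OF dvd_refl])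
      then show "2 * (9 * fact (n - 9)) dvd 3 * (fact (n - 3) :: nat)" by simp
    qed
    finally have "linked n y h" using link alt yid by blast
    moreover have "linked n y x" using linked_power[of n y 3] alt y x n by simp
    ultimately show ?thesis using h linked_sym linked_trans by blast
  qed
  then show ?thesis using that by blast
qed

text \<open>
  With at least three transpositions, rotate three of them; otherwise at most four points are
  moved and \<open>n \<ge> 9\<close> leaves room for a disjoint 3-cycle.
\<close>
lemma linked_three_cycle_of_involution:
  assumes n: "n \<ge> 9" and x: "x \<in> alt n" "x \<noteq> id" "x ^^ 2 = id"
  obtains c where "three_cycle n c" "linked n x c"
proof -
  interpret prime_order_perm "{1..n}" x 2
    using alt_prime_order_perm x two_is_prime_nat by (simp add: alt_group_carrier)
  obtain T where T: "independent T" "finite T" "card (moved x) = 2 * card T"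
    using exists_orbits_cover[OF x(2)] by metis
  have n4: "n \<ge> 4" using n by simp
  show ?thesis
  proof (cases "card T \<ge> 3")
    case True
    then obtain U where U: "U \<subseteq> T" "card U = 3" by (meson obtain_subset_with_card_n)
    then have "independent U" using T independent_subset by blast
    then obtain r where r: "r \<in> alt n" "r \<noteq> id" "r ^^ 3 = id" "card (moved r) \<le> 3 * 2" "linked n x r"
      using linked_rotation[OF n4 x(1,2) _ prime_order_perm_axioms _ U(2)] by auto
    then obtain c where "three_cycle n c" "linked n r c"
      using linked_three_cycle_of_small_order_3[OF n r(1-3)] by auto
    with r show ?thesis using that linked_trans by blast
  next
    case False
    then show ?thesis
      using linked_disjoint_three_cycle[OF n4 x(1,2) prime order] T n that by force
  qed
qed

lemma linked_three_cycle_of_order_3: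
  assumes n: "n \<ge> 9" and x: "x \<in> alt n" "x \<noteq> id" "x ^^ 3 = id"
  obtains c where "three_cycle n c" "linked n x c"
proof -
  interpret prime_order_perm "{1..n}" x 3
    using alt_prime_order_perm x by (simp add: alt_group_carrier)
  obtain T where T: "independent T" "finite T" "card (moved x) = 3 * card T"
    using exists_orbits_cover[OF x(2)] by metis
  have n4: "n \<ge> 4" using n by simp
  show ?thesis
  proof (cases "card T \<ge> 4")
    case True
    then obtain U where U: "U \<subseteq> T" "card U = 4" by (meson obtain_subset_with_card_n)
    then have "independent U" using T independent_subset by blast
    then obtain s where s: "s \<in> alt n" "s \<noteq> id" "s ^^ 2 = id" "linked n x s"
      using linked_double_swap[OF n4 x(1,2) _ prime_order_perm_axioms _ U(2)] by auto
    then obtain c where "three_cycle n c" "linked n s c"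
      using linked_three_cycle_of_involution[OF n s(1-3)] by auto
    with s show ?thesis using that linked_trans by blast
  next
    case False
    then show ?thesis using linked_three_cycle_of_small_order_3[OF n x] T that by auto
  qed
qed

text \<open>
  The hypothesis \<open>q + 3 \<le> n\<close> is what provides the disjoint 3-cycle when \<open>x\<close> is a single
  \<open>q\<close>-cycle; the remaining cases follow the number of cycles of \<open>x\<close>.
\<close>
lemma linked_three_cycle_of_prime_order:
  assumes n: "n \<ge> 9" and x: "x \<in> alt n" "x \<noteq> id" and q: "prime q" "x ^^ q = id" "q + 3 \<le> n"
  obtains c where "three_cycle n c" "linked n x c"
proof -
  consider "q = 2" | "q = 3" | "q \<ge> 5"
  proof -
    have "q \<noteq> 4" using prime_odd_nat[OF q(1)] by auto
    moreover have "q \<ge> 2" using q(1) by (rule prime_ge_2_nat)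
    ultimately show ?thesis using that by linarith
  qed
  then show ?thesis
  proof cases
    case 1 then show ?thesis using linked_three_cycle_of_involution[OF n x] q that by blast
  next
    case 2 then show ?thesis using linked_three_cycle_of_order_3[OF n x] q that by blast
  next
    case 3
    interpret prime_order_perm "{1..n}" x q
      using alt_prime_order_perm x q by (simp add: alt_group_carrier)
    have n4: "n \<ge> 4" and q3: "q \<noteq> 3" using n 3 by auto
    obtain T where T: "independent T" "moved x = (\<Union>u\<in>T. orbit x u)" "finite T" "T \<noteq> {}"
      "card (moved x) = q * card T"
      using exists_orbits_cover[OF x(2)] .
    have "card T > 0" using T by (simp add: card_gt_0_iff)
    then consider "card T = 1" | "card T = 2" | "card T \<ge> 3" by linarith
    then show ?thesis
    proof cases
      case 1
      then show ?thesis
        using linked_disjoint_three_cycle[OF n4 x prime order q3] T q that by auto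
    next
      case 2
      then obtain u v where uv: "T = {u, v}" "u \<noteq> v" by (auto simp: card_2_iff)
      obtain a where a: "a \<in> alt n" "a \<noteq> id" "a ^^ q = id" "card (moved a) = q" "linked n x a" "2 * q \<le> n"
        using linked_two_orbits[OF n x prime_order_perm_axioms 3, of u v] T uv by auto
      then obtain c where "three_cycle n c" "linked n a c"
        using linked_disjoint_three_cycle[OF n4 a(1,2) prime a(3) q3] 3 by auto
      with a show ?thesis using that linked_trans by blast
    next
      case 3
      then obtain U where U: "U \<subseteq> T" "card U = 3" by (meson obtain_subset_with_card_n)
      then have "independent U" using T independent_subset by blast
      then obtain r where r: "r \<in> alt n" "r \<noteq> id" "r ^^ 3 = id" "linked n x r"
        using linked_rotation[OF n4 x q3 prime_order_perm_axioms _ U(2)] by auto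
      then obtain c where "three_cycle n c" "linked n r c"
        using linked_three_cycle_of_order_3[OF n r(1-3)] by auto
      with r show ?thesis using that linked_trans by blast
    qed
  qed
qed

theorem theorem16:
  fixes n :: nat
  assumes "n \<ge> 9"
  shows "(\<forall>p \<delta>. prime p \<and> p \<ge> n - 2 \<and> \<delta> \<in> carrier (alt_group n) \<and> \<delta> \<noteq> \<one>\<^bsub>alt_group n\<^esub> \<and>
             \<delta> \<in> k_cycles n p \<longrightarrow>
           isolated_vertex (div_graph (alt_group n)) (div_vertex (alt_group n) \<delta>)) \<and>
         (\<exists>C \<in> conn_components (div_graph (alt_group n)).
           {v \<in> pverts (div_graph (alt_group n)).
             \<not> (\<exists>p \<delta>. prime p \<and> p \<ge> n - 2 \<and> \<delta> \<in> carrier (alt_group n) \<and> \<delta> \<in> k_cycles n p \<and>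
                     v = div_vertex (alt_group n) \<delta>)}
           \<subseteq> verts C)"
proof (intro conjI allI impI)
  fix p \<delta>
  assume d: "prime p \<and> p \<ge> n - 2 \<and> \<delta> \<in> carrier (alt_group n) \<and> \<delta> \<noteq> \<one>\<^bsub>alt_group n\<^esub> \<and>
    \<delta> \<in> k_cycles n p"
  then have "\<delta> ^^ p = id" using cycle_is_id_root by (auto simp: k_cycles_def)
  with d show "isolated_vertex (div_graph (alt_group n)) (div_vertex (alt_group n) \<delta>)"
    using isolated_large_prime[OF assms, of \<delta> p] by (simp add: alt_group_one)
next
  let ?v = "div_vertex (alt_group n)"
  have n4: "n \<ge> 4" using assms by simp
  define h where "h = cycle_of_list [1, 2, 3 :: nat]"
  have h: "three_cycle n h" unfolding h_def using assms by (intro three_cycle_cycle_of_list) auto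
  have "h \<in> alt n" "h \<noteq> id" using h three_cycle_neq_id by (auto simp: three_cycle_def)
  then obtain C where C: "C \<in> conn_components (div_graph (alt_group n))"
    "verts C = {v. v \<rightarrow>\<^sup>*\<^bsub>with_proj (div_graph (alt_group n))\<^esub> ?v h}"
    using component_of_linked[OF n4] by blast
  have main: "linked n g h" if g: "g \<in> alt n" "g \<noteq> id"
    and no: "\<not> (\<exists>p \<delta>. prime p \<and> p \<ge> n - 2 \<and> \<delta> \<in> alt n \<and> \<delta> \<in> k_cycles n p \<and> ?v g = ?v \<delta>)" for g
  proof -
    have "permutation g" using g alt_group_carrier' by blast
    then obtain q k where q: "prime q" "(g ^^ k) ^^ q = id" "g ^^ k \<noteq> id"
      using exists_prime_order_power g(2) by metis
    let ?x = "g ^^ k"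
    have x: "?x \<in> alt n" using g alt_funpow by blast
    \<comment> \<open>for larger \<open>q\<close>, the vertex of \<open>g\<close> would be that of the \<open>q\<close>-cycle \<open>?x\<close>\<close>
    have "q < n - 2"
    proof (rule ccontr)
      assume "\<not> q < n - 2"
      then have cyc: "?x \<in> k_cycles n q" "card (alt_cent n ?x) = q" and ge: "q \<ge> n - 2"
        using card_alt_cent_large_prime[OF assms _ q(3,1) _ q(2)] x by (auto simp: alt_group_carrier)
      have "card (alt_cent n g) dvd q"
        using card_alt_cent_dvd[OF g(1) x alt_cent_funpow_subset] cyc by simp
      then have "card (alt_cent n g) = q"
        using q(1) card_alt_cent_gt_1[OF g] by (auto simp: prime_nat_iff)
      then have "card (alt_cent n g) = card (alt_cent n ?x)" using cyc(2) by (rule trans[OF _ sym])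
      then have "?v g = ?v ?x" by (rule div_vertex_eqI[OF g(1) x])
      with no show False using q(1) ge x cyc(1) by blast
    qed
    then have "q + 3 \<le> n" by linarith
    then obtain c where "three_cycle n c" "linked n ?x c"
      using linked_three_cycle_of_prime_order[OF assms x q(3,1,2)] by auto
    moreover have "linked n g ?x" using linked_power[OF n4 g(1) q(3)] .
    moreover have "linked n c h" using linked_three_cycles calculation h assms by simp
    ultimately show ?thesis using linked_trans by blast
  qed
  show "\<exists>C \<in> conn_components (div_graph (alt_group n)).
           {v \<in> pverts (div_graph (alt_group n)).
             \<not> (\<exists>p \<delta>. prime p \<and> p \<ge> n - 2 \<and> \<delta> \<in> carrier (alt_group n) \<and> \<delta> \<in> k_cycles n p \<and>
                     v = div_vertex (alt_group n) \<delta>)}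
           \<subseteq> verts C"
    using C main pverts_alt[OF n4] by (intro bexI[of _ C]) (auto simp: linked_def)
qed

end
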